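(* Let $\rho^*=e^{-U}$ on $\mathbb{R}$ with $U(x)=\frac{x^2}{2}+\ln\sqrt{2\pi}$ and let $F[\rho]=\mathrm{KL}[\rho|\rho^*]$ for $\rho\in\mathcal{P}_2(\mathbb{R})$. Let $\rho_0(x)=\frac{1}{D_0}e^{-V_0(x)}$ with $V_0(x)=\frac{x^2}{2}$ for $x\in(-1,1)$, $V_0(x)=|x|-\frac12$ otherwise, and $D_0=\int_{\mathbb{R}}e^{-V_0(x)}dx$. Let $(h_n)_{n\ge0}$ be step sizes with $h_n\in(0,1)$, and let $\rho_{n+1}=(T_n)_\#\rho_n$, where $T_n(x)=x-h_n\nabla\frac{\delta F}{\delta\rho}\big|_{\rho_n}(x)$, the velocity being given $\rho_n$-a.e. by $\nabla\frac{\delta F}{\delta\rho}\big|_{\rho_n}=\nabla U+\nabla\ln\rho_n$. Then: (1) The measure $\rho_1$ is Lebesgue absolutely continuous, but its density is discontinuous, with a discontinuity set of Lebesgue measure zero, and $\rho_1\in S_F^{\mathrm{f}}\setminus S_F^{W}$. (2) For each $n\ge0$ there exist constants $a_n,c_n\in[1,\infty)$ and $b_n\in\mathbb{R}$ such that the density of $\rho_n$ is $$\rho_n(x)=\begin{cases}\frac{1}{D_0}\exp\left(-\frac{x^2}{2}\right)& x\in[0,1)\\ 0& x\in[1,c_n)\\ \exp(-a_nx+b_n)& x\in[c_n,+\infty)\\ \rho_n(-x)& x\in(-\infty,0).\end{cases}$$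
   Context: $\mathcal{P}_2(\Omega)$ is the set of probability measures on $\Omega$ with finite second moment; here $\Omega=\mathbb{R}$. The same symbol denotes a measure and its Lebesgue density. $T_\#\rho$ denotes the pushforward. $\mathrm{KL}[\rho|\rho^*]=\int \frac{d\rho}{d\rho^*}\ln\left(\frac{d\rho}{d\rho^*}\right)d\rho^*$ if $\rho\ll\rho^*$, and $+\infty$ otherwise. For $F:\mathcal{P}_2(\Omega)\to\mathbb{R}\cup\{\infty\}$, $D(F)=\{\mu\in\mathcal{P}_2(\Omega):F[\mu]<\infty\}$. First variation: a function $\frac{\delta F}{\delta\rho}\big|_\rho:\Omega\to\mathbb{R}\cup\{\infty\}$ is the first variation of $F$ at $\rho$ if for all $\nu\in D(F)$, $\int\frac{\delta F}{\delta\rho}\big|_\rho(x)\,d(\nu-\rho)(x)=\frac{d}{d\epsilon}F[(1-\epsilon)\rho+\epsilon\nu]\big|_{\epsilon=0}$ (derivative from the right). For $F=\mathrm{KL}[\cdot|e^{-U}]$ and $\rho=e^{-V}$, the first variation is $1+U-V$, with gradient $\nabla U-\nabla V$; this formula for the gradient, evaluated $\rho_n$-a.e., is the velocity used in the forward Euler scheme. Define $S_F^{\mathrm{f}}=\{\rho\in D(F):\nabla\frac{\delta F}{\delta\rho}\big|_\rho\text{ exists }\rho\text{-a.e.}\}$. Wasserstein differentiability: $\xi\in L^2(\rho;\mathbb{R}^d)$ is a Wasserstein gradient of $F$ at $\rho\in D(F)$ if for all $\nu\in D(F)$, $F[\nu]=F[\rho]+\int_{\Omega\times\Omega}\langle\xi(x),y-x\rangle\,d\pi(x,y)+o(W_2(\rho,\nu))$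 for some $\pi\in\Pi_o(\rho,\nu)$, where $\Pi_o(\rho,\nu)$ is the set of optimal transport plans for the quadratic cost between $\rho$ and $\nu$. The set of such $\xi$ is $\nabla_W F[\rho]$, and $S_F^{W}=\{\rho\in D(F):\nabla_W F[\rho]\neq\emptyset\}$. *)

theory Defs
  imports "HOL-Probability.Probability"
begin

definition P2 :: "real measure set" where
  "P2 = {\<mu>. prob_space \<mu> \<and> sets \<mu> = sets borel \<and> (\<integral>\<^sup>+x. ennreal (x\<^sup>2) \<partial>\<mu>) < \<infinity>}"

definition is_lebesgue_density :: "real measure \<Rightarrow> (real \<Rightarrow> real) \<Rightarrow> bool" where
  "is_lebesgue_density \<mu> f \<longleftrightarrow>
     f \<in> borel_measurable borel \<and> (\<forall>x. 0 \<le> f x) \<and> \<mu> = density lborel (\<lambda>x. ennreal (f x))"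

text \<open>Integrals of extended-real functions. The value is meaningful only if the positive and the
  negative part do not both have infinite integral (\<open>\<infinity> - \<infinity> = \<infinity>\<close> for the type \<open>ereal\<close>).\<close>

definition quasi_integrable :: "'a measure \<Rightarrow> ('a \<Rightarrow> ereal) \<Rightarrow> bool" where
  "quasi_integrable M \<phi> \<longleftrightarrow> \<phi> \<in> borel_measurable M \<and>
     ((\<integral>\<^sup>+x. e2ennreal (\<phi> x) \<partial>M) < \<infinity> \<or> (\<integral>\<^sup>+x. e2ennreal (- \<phi> x) \<partial>M) < \<infinity>)"

definition ext_integral :: "'a measure \<Rightarrow> ('a \<Rightarrow> ereal) \<Rightarrow> ereal" where
  "ext_integral M \<phi> =
     enn2ereal (\<integral>\<^sup>+x. e2ennreal (\<phi> x) \<partial>M) - enn2ereal (\<integral>\<^sup>+x. e2ennreal (- \<phi> x) \<partial>M)"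

text \<open>The library's \<open>KL_divergence\<close> is real-valued and is \<open>0\<close> for a non-integrable integrand, so it
  cannot express the value \<open>\<infinity>\<close>. Below, \<open>r ln r \<ge> - 1 / e\<close> makes the negative part integrable
  whenever \<open>\<nu>\<close> is finite, and \<open>0 * ln 0 = 0\<close>.\<close>

definition KL :: "real measure \<Rightarrow> real measure \<Rightarrow> ereal" where
  "KL \<mu> \<nu> =
     (if absolutely_continuous \<nu> \<mu>
      then ext_integral \<nu>
        (\<lambda>x. ereal (enn2real (RN_deriv \<nu> \<mu> x) * ln (enn2real (RN_deriv \<nu> \<mu> x))))
      else \<infinity>)"

definition dom_F :: "(real measure \<Rightarrow> ereal) \<Rightarrow> real measure set" where
  "dom_F F = {\<mu> \<in> P2. F \<mu> < \<infinity>}"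

definition mixture :: "real \<Rightarrow> real measure \<Rightarrow> real measure \<Rightarrow> real measure" where
  "mixture \<epsilon> \<mu> \<nu> = measure_of UNIV (sets borel)
     (\<lambda>A. ennreal (1 - \<epsilon>) * emeasure \<mu> A + ennreal \<epsilon> * emeasure \<nu> A)"

text \<open>The integral of \<open>\<phi>\<close> against the signed measure \<open>\<nu> - \<rho>\<close> is the difference of the integrals
  against \<open>\<nu>\<close> and \<open>\<rho>\<close>; it is well defined because \<open>\<phi>\<close> is required to be \<open>\<rho>\<close>-integrable.\<close>

definition is_first_variation ::
    "(real measure \<Rightarrow> ereal) \<Rightarrow> real measure \<Rightarrow> (real \<Rightarrow> ereal) \<Rightarrow> bool" where
  "is_first_variation F \<rho> \<phi> \<longleftrightarrow>
     \<phi> \<in> borel_measurable borel \<and> (\<forall>x. \<phi> x \<noteq> -\<infinity>) \<and> (\<integral>\<^sup>+x. e2ennreal \<bar>\<phi> x\<bar> \<partial>\<rho>) < \<infinity> \<and>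
     (\<forall>\<nu>\<in>dom_F F. quasi_integrable \<nu> \<phi> \<and>
        ((\<lambda>\<epsilon>. (F (mixture \<epsilon> \<rho> \<nu>) - F \<rho>) / ereal \<epsilon>)
          \<longlongrightarrow> ext_integral \<nu> \<phi> - ext_integral \<rho> \<phi>) (at_right 0))"

definition has_gradient :: "(real \<Rightarrow> ereal) \<Rightarrow> real \<Rightarrow> real \<Rightarrow> bool" where
  "has_gradient \<phi> D x \<longleftrightarrow>
     eventually (\<lambda>y. \<bar>\<phi> y\<bar> \<noteq> \<infinity>) (nhds x) \<and>
     ((\<lambda>y. real_of_ereal (\<phi> y)) has_real_derivative D) (at x)"

text \<open>First variations of the entropy are determined only up to Lebesgue null sets (and constants),
  hence the existential choice of a representative.\<close>

definition S_f :: "(real measure \<Rightarrow> ereal) \<Rightarrow> real measure set" where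
  "S_f F = {\<rho> \<in> dom_F F.
     \<exists>\<phi>. is_first_variation F \<rho> \<phi> \<and> (AE x in \<rho>. \<exists>D. has_gradient \<phi> D x)}"

definition couplings :: "real measure \<Rightarrow> real measure \<Rightarrow> (real \<times> real) measure set" where
  "couplings \<mu> \<nu> = {\<pi>. sets \<pi> = sets borel \<and> distr \<pi> borel fst = \<mu> \<and> distr \<pi> borel snd = \<nu>}"

definition transport_cost :: "(real \<times> real) measure \<Rightarrow> ennreal" where
  "transport_cost \<pi> = (\<integral>\<^sup>+z. ennreal ((fst z - snd z)\<^sup>2) \<partial>\<pi>)"

definition W2 :: "real measure \<Rightarrow> real measure \<Rightarrow> real" where
  "W2 \<mu> \<nu> = sqrt (enn2real (INF \<pi>\<in>couplings \<mu> \<nu>. transport_cost \<pi>))"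

definition optimal_plans :: "real measure \<Rightarrow> real measure \<Rightarrow> (real \<times> real) measure set" where
  "optimal_plans \<mu> \<nu> =
     {\<pi> \<in> couplings \<mu> \<nu>. \<forall>\<pi>'\<in>couplings \<mu> \<nu>. transport_cost \<pi> \<le> transport_cost \<pi>'}"

definition W_gradients :: "(real measure \<Rightarrow> ereal) \<Rightarrow> real measure \<Rightarrow> (real \<Rightarrow> real) set" where
  "W_gradients F \<rho> =
     {\<xi>. \<xi> \<in> borel_measurable borel \<and> integrable \<rho> (\<lambda>x. (\<xi> x)\<^sup>2) \<and>
        (\<exists>\<pi>. (\<forall>\<nu>\<in>dom_F F. \<pi> \<nu> \<in> optimal_plans \<rho> \<nu>) \<and>
           (\<forall>e>0. \<exists>d>0. \<forall>\<nu>\<in>dom_F F. W2 \<rho> \<nu> < d \<longrightarrow>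
              \<bar>real_of_ereal (F \<nu>) - real_of_ereal (F \<rho>)
                 - (\<integral>z. \<xi> (fst z) * (snd z - fst z) \<partial>\<pi> \<nu>)\<bar> \<le> e * W2 \<rho> \<nu>))}"

definition S_W :: "(real measure \<Rightarrow> ereal) \<Rightarrow> real measure set" where
  "S_W F = {\<rho> \<in> dom_F F. W_gradients F \<rho> \<noteq> {}}"

text \<open>The formula \<open>\<nabla>U + \<nabla>ln \<rho>\<close>, evaluated \<open>\<rho>\<close>-a.e. Positivity near \<open>x\<close> excludes the
  convention \<open>ln 0 = 0\<close>. Since a density may be changed on a null set, some representative with the
  required derivatives is used; the result does not depend on it (lemma \<open>is_KL_velocity_unique\<close>).\<close>

definition has_log_gradient :: "(real \<Rightarrow> real) \<Rightarrow> real \<Rightarrow> real \<Rightarrow> bool" where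
  "has_log_gradient f D x \<longleftrightarrow>
     eventually (\<lambda>y. 0 < f y) (nhds x) \<and> ((\<lambda>y. ln (f y)) has_real_derivative D) (at x)"

definition is_KL_velocity :: "(real \<Rightarrow> real) \<Rightarrow> real measure \<Rightarrow> (real \<Rightarrow> real) \<Rightarrow> bool" where
  "is_KL_velocity U \<rho> v \<longleftrightarrow> v \<in> borel_measurable borel \<and>
     (\<exists>f. is_lebesgue_density \<rho> f \<and>
        (AE x in \<rho>. \<exists>D E. (U has_real_derivative D) (at x) \<and> has_log_gradient f E x \<and>
           v x = D + E))"

lemma is_KL_velocity_unique:
  assumes "is_KL_velocity U \<rho> v" "is_KL_velocity U \<rho> w"
  shows "AE x in \<rho>. v x = w x"
proof -
  obtain f where f: "is_lebesgue_density \<rho> f"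
    and fv: "AE x in \<rho>. \<exists>D E. (U has_real_derivative D) (at x) \<and> has_log_gradient f E x \<and> v x = D + E"
    using assms(1) unfolding is_KL_velocity_def by blast
  obtain g where g: "is_lebesgue_density \<rho> g"
    and gw: "AE x in \<rho>. \<exists>D E. (U has_real_derivative D) (at x) \<and> has_log_gradient g E x \<and> w x = D + E"
    using assms(2) unfolding is_KL_velocity_def by blast
  have fm: "f \<in> borel_measurable borel" "g \<in> borel_measurable borel"
    and pos: "\<And>x. 0 \<le> f x" "\<And>x. 0 \<le> g x"
    and eq: "density lborel (\<lambda>x. ennreal (f x)) = density lborel (\<lambda>x. ennreal (g x))"
    using f g unfolding is_lebesgue_density_def by auto
  have "AE x in lborel. ennreal (f x) = ennreal (g x)"
    using sigma_finite_measure.density_unique_iff[OF sigma_finite_lborel, of "\<lambda>x. ennreal (f x)" "\<lambda>x. ennreal (g x)"] fm eq by simp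
  then have "AE x in lborel. f x = g x"
    using pos by (auto elim!: eventually_mono)
  then have null: "{x. f x \<noteq> g x} \<in> null_sets lborel"
    using fm by (subst (asm) AE_iff_null) auto
  have dense: "\<exists>y. y \<in> S \<and> f y = g y" if "open S" "S \<noteq> {}" for S :: "real set"
  proof (rule ccontr)
    assume "\<not> ?thesis"
    then have "S \<subseteq> {x. f x \<noteq> g x}" by auto
    then have "S \<in> null_sets lborel"
      using null_sets_subset[OF null] that(1) by simp
    then have "negligible S"
      unfolding negligible_iff_null_sets by (rule null_sets_completionI)
    then show False
      using that open_not_negligible by blast
  qed
  have E_eq: "E = E'" if "has_log_gradient f E x" "has_log_gradient g E' x" for E E' x
  proof -
    let ?k = "\<lambda>y. ln (f y) - ln (g y)"
    have d: "(?k has_real_derivative (E - E')) (at x)"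
      using that unfolding has_log_gradient_def by (auto intro: DERIV_diff)
    have "\<exists>y. y \<in> {x<..<x + inverse (real (Suc n))} \<and> f y = g y" for n
      by (rule dense) auto
    then obtain Y where Y: "\<And>n. Y n \<in> {x<..<x + inverse (real (Suc n))} \<and> f (Y n) = g (Y n)"
      by metis
    have Yb: "x < Y n" "Y n < x + inverse (real (Suc n))" "f (Y n) = g (Y n)" "Y n \<noteq> x" for n
      using Y[of n] by auto
    have "Y \<longlonglongrightarrow> x"
    proof (rule tendsto_sandwich[of "\<lambda>_. x" Y sequentially "\<lambda>n. x + inverse (real (Suc n))"])
      show "(\<lambda>n. x + inverse (real (Suc n))) \<longlonglongrightarrow> x"
        using tendsto_add[OF tendsto_const LIMSEQ_inverse_real_of_nat, of x] by simp
    qed (use Yb in \<open>auto intro!: always_eventually less_imp_le simp del: of_nat_Suc\<close>)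
    then have lim: "filterlim Y (at x) sequentially"
      using Yb unfolding filterlim_at by simp
    have "isCont ?k x" using d DERIV_isCont by blast
    then have "(\<lambda>n. ?k (Y n)) \<longlonglongrightarrow> ?k x"
      using \<open>Y \<longlonglongrightarrow> x\<close> isCont_tendsto_compose by blast
    then have "?k x = 0" using Yb by (simp add: LIMSEQ_const_iff)
    moreover have "(\<lambda>n. (?k (Y n) - ?k x) / (Y n - x)) \<longlonglongrightarrow> E - E'"
      using d lim unfolding has_field_derivative_iff by (rule filterlim_compose)
    ultimately have "(\<lambda>n::nat. 0::real) \<longlonglongrightarrow> E - E'" using Yb by simp
    then show ?thesis by (simp add: LIMSEQ_const_iff)
  qed
  show ?thesis
    using fv gw
  proof eventually_elim
    case (elim x)
    then show ?case using E_eq DERIV_unique by metis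
  qed
qed

definition KL_velocity :: "(real \<Rightarrow> real) \<Rightarrow> real measure \<Rightarrow> real \<Rightarrow> real" where
  "KL_velocity U \<rho> = (SOME v. is_KL_velocity U \<rho> v)"

end

theory Submission
  imports Defs
begin

text \<open>The velocity vanishes on the Gaussian core \<open>(-1, 1)\<close> and is affine on the exponential tails, so each
  step fixes the core, maps \<open>x \<mapsto> (1 - h) x + h a\<close> on the right tail and turns the rate \<open>a\<close> into
  \<open>a / (1 - h)\<close>. The first step leaves the tail attached at \<open>1\<close> but multiplies its height there by
  \<open>1 / (1 - h)\<close>, which creates a jump. The density stays positive with a logarithm of at most quadratic
  growth, so the first variation of the divergence exists: by convexity of \<open>t ln t\<close> the difference
  quotients lie between the tangent and the chord. The jump rules out Wasserstein differentiability,
  since a Wasserstein gradient bounds the slope whereas smoothing the jump has infinite slope.\<close>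

subsection \<open>Relative entropy of densities and its first variation\<close>

text \<open>Three points shape the argument. First, the tail map
  \<open>x \<mapsto> (1 - h) x + h a\<close> has the fixed point \<open>a\<close>, so it sends the
  left end \<open>c\<close> of the tail to a convex combination of \<open>c\<close> and
  \<open>a\<close>. At the first step \<open>c = a = 1\<close>, so no gap opens and the density of
  \<rho> 1 is positive everywhere; from the second step on \<open>a > 1\<close> pulls the tail away
  from the core. Second, densities and velocities are determined only up to null sets and the
  velocity is obtained by choice. Every computation is therefore done with an explicit
  representative and transferred almost everywhere; in particular the discontinuity must be shown
  for all representatives. Third, only one direction of control on the distance is needed to refute
  Wasserstein differentiability: a single cheap coupling bounds \<open>W2\<close> from above, while
  convexity bounds the drop of the divergence from below.\<close>

lemma xlnx_ge:
  fixes t :: real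
  assumes "0 \<le> t"
  shows "- 1 \<le> t * ln t"
proof (cases "t = 0")
  case False
  then have t: "0 < t" using assms by simp
  have "- ln t \<le> inverse t - 1"
    using ln_le_minus_one[of "inverse t"] t by (simp add: ln_inverse)
  then have "t * (- ln t) \<le> t * (inverse t - 1)"
    using assms by (rule mult_left_mono)
  also have "\<dots> = 1 - t" using t by (simp add: field_simps)
  finally show ?thesis using t by simp
qed simp

lemma xlnx_tangent:
  fixes t u :: real
  assumes t: "0 < t" and u: "0 \<le> u"
  shows "(1 + ln t) * (u - t) \<le> u * ln u - t * ln t"
proof (cases "u = 0")
  case False
  then have u: "0 < u" using u by simp
  have "ln t - ln u \<le> t / u - 1"
    using ln_le_minus_one[of "t / u"] t u by (simp add: ln_div)
  then have "u * (ln t - ln u) \<le> u * (t / u - 1)"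
    using u by (simp add: mult_left_mono)
  then show ?thesis using u by (simp add: algebra_simps)
qed (use t in \<open>simp add: algebra_simps\<close>)

text \<open>Jensen's inequality from two tangents, both taken at the mixture point: in the weighted
  sum their linear parts cancel. The value \<open>s = 0\<close> is covered because the tangent bound
  admits 0.\<close>

lemma xlnx_convex:
  fixes r s e :: real
  assumes r: "0 < r" and s: "0 \<le> s" and e: "0 \<le> e" "e < 1"
  shows "((1 - e) * r + e * s) * ln ((1 - e) * r + e * s)
      \<le> (1 - e) * (r * ln r) + e * (s * ln s)"
proof -
  define t where "t = (1 - e) * r + e * s"
  have t: "0 < t" unfolding t_def using r s e by (intro add_pos_nonneg) auto
  have "(1 - e) * ((1 + ln t) * (r - t)) + e * ((1 + ln t) * (s - t))
      \<le> (1 - e) * (r * ln r - t * ln t) + e * (s * ln s - t * ln t)"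
    by (intro add_mono mult_left_mono xlnx_tangent) (use r s e t in auto)
  moreover have "(1 - e) * ((1 + ln t) * (r - t)) + e * ((1 + ln t) * (s - t))
      = (1 + ln t) * ((1 - e) * r + e * s - t)"
    by (simp add: algebra_simps)
  moreover have "(1 - e) * (r * ln r - t * ln t) + e * (s * ln s - t * ln t)
      = (1 - e) * (r * ln r) + e * (s * ln s) - t * ln t"
    by (simp add: algebra_simps)
  ultimately have "t * ln t \<le> (1 - e) * (r * ln r) + e * (s * ln s)"
    by (simp add: t_def[symmetric])
  then show ?thesis unfolding t_def .
qed

lemma ext_integral_ereal:
  assumes "integrable M f"
  shows "ext_integral M (\<lambda>x. ereal (f x)) = ereal (\<integral>x. f x \<partial>M)"
proof -
  obtain a where a: "(\<integral>\<^sup>+x. ennreal (f x) \<partial>M) = ennreal a" "0 \<le> a"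
    using assms unfolding real_integrable_def by (metis ennreal_cases infinity_ennreal_def)
  obtain b where b: "(\<integral>\<^sup>+x. ennreal (- f x) \<partial>M) = ennreal b" "0 \<le> b"
    using assms unfolding real_integrable_def by (metis ennreal_cases infinity_ennreal_def)
  show ?thesis
    using a b by (simp add: ext_integral_def real_lebesgue_integral_def[OF assms] enn2ereal_ennreal)
qed

lemma KL_density:
  assumes N: "prob_space N" and u: "u \<in> borel_measurable N" "\<And>x. 0 \<le> u x"
    and int: "integrable N (\<lambda>x. u x * ln (u x))"
  shows "KL (density N (\<lambda>x. ennreal (u x))) N = ereal (\<integral>x. u x * ln (u x) \<partial>N)"
proof -
  interpret N: prob_space N by fact
  let ?M = "density N (\<lambda>x. ennreal (u x))"
  have "absolutely_continuous N ?M"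
    using u by (intro absolutely_continuousI_density) auto
  moreover have ae: "AE x in N. enn2real (RN_deriv N ?M x) = u x"
    using N.RN_deriv_unique[OF _ refl, of "\<lambda>x. ennreal (u x)"] u
    by (auto elim!: eventually_mono) (metis enn2real_ennreal)
  have "ext_integral N (\<lambda>x. ereal (enn2real (RN_deriv N ?M x) * ln (enn2real (RN_deriv N ?M x))))
      = ext_integral N (\<lambda>x. ereal (u x * ln (u x)))"
    unfolding ext_integral_def
    by (intro arg_cong2[where f = "(-)"] arg_cong[where f = enn2ereal] nn_integral_cong_AE)
      (use ae in \<open>auto elim!: eventually_mono\<close>)
  ultimately show ?thesis
    by (simp add: KL_def ext_integral_ereal[OF int])
qed

text \<open>Since \<open>t ln t \<ge> -1\<close> and \<open>N\<close> has mass 1, the negative part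
  of the integrand has integral at most 1, so an infinite positive part would make the divergence
  infinite. Finite divergence thus yields a real density with integrable entropy, and limits can be
  taken with Bochner integrals.\<close>

lemma KL_finiteE:
  assumes N: "prob_space N" and M: "prob_space M" and sets: "sets M = sets N"
    and fin: "KL M N < \<infinity>"
  obtains u where "u \<in> borel_measurable N" "\<And>x. 0 \<le> u x"
    "M = density N (\<lambda>x. ennreal (u x))" "integrable N (\<lambda>x. u x * ln (u x))"
proof -
  interpret N: prob_space N by fact
  interpret M: prob_space M by fact
  define u where "u = (\<lambda>x. enn2real (RN_deriv N M x))"
  have ac: "absolutely_continuous N M" using fin by (auto simp: KL_def split: if_splits)
  have u: "u \<in> borel_measurable N" "\<And>x. 0 \<le> u x" by (auto simp: u_def)
  have "AE x in N. RN_deriv N M x \<noteq> \<infinity>"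
    by (rule N.RN_deriv_finite[OF M.sigma_finite_measure_axioms ac sets])
  then have "density N (\<lambda>x. ennreal (u x)) = density N (RN_deriv N M)"
    using u by (intro density_cong) (auto elim!: eventually_mono simp: u_def less_top)
  then have M_eq: "M = density N (\<lambda>x. ennreal (u x))"
    using N.density_RN_deriv[OF ac sets] by simp
  let ?g = "\<lambda>x. u x * ln (u x)"
  have neg: "(\<integral>\<^sup>+x. ennreal (- ?g x) \<partial>N) < \<infinity>"
  proof -
    have "(\<integral>\<^sup>+x. ennreal (- ?g x) \<partial>N) \<le> (\<integral>\<^sup>+x. 1 \<partial>N)"
      using xlnx_ge[OF u(2)] by (intro nn_integral_mono) (auto simp flip: ennreal_1 intro!: ennreal_leI simp: minus_le_iff)
    then show ?thesis by (auto simp: N.emeasure_space_1 less_top[symmetric] top_unique)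
  qed
  have pos: "(\<integral>\<^sup>+x. ennreal (?g x) \<partial>N) \<noteq> \<infinity>"
  proof
    assume "(\<integral>\<^sup>+x. ennreal (?g x) \<partial>N) = \<infinity>"
    moreover obtain b where "(\<integral>\<^sup>+x. ennreal (- ?g x) \<partial>N) = ennreal b" "0 \<le> b"
      using neg by (metis ennreal_cases infinity_ennreal_def less_irrefl)
    ultimately have "KL M N = \<infinity>"
      using ac by (simp add: KL_def u_def ext_integral_def enn2ereal_ennreal)
    then show False using fin by simp
  qed
  have "integrable N ?g"
    using u neg pos by (auto simp: real_integrable_def)
  then show ?thesis using that u M_eq by blast
qed

text \<open>\<open>mixture\<close> is made by \<open>measure_of\<close> from a bare set function,
  whose values carry over only once it is known to be a measure. It is recognised here as the
  measure of a density.\<close>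

lemma mixture_density:
  fixes N :: "real measure"
  assumes N: "sets N = sets borel" and r: "r \<in> borel_measurable N" "\<And>x. 0 \<le> r x"
    and s: "s \<in> borel_measurable N" "\<And>x. 0 \<le> s x" and e: "0 \<le> e" "e \<le> 1"
  shows "mixture e (density N (\<lambda>x. ennreal (r x))) (density N (\<lambda>x. ennreal (s x)))
     = density N (\<lambda>x. ennreal ((1 - e) * r x + e * s x))" (is "_ = ?D")
proof -
  have "?D = measure_of (space ?D) (sets ?D) (emeasure ?D)"
    by (rule measure_of_of_measure[symmetric])
  also have "\<dots> = measure_of UNIV (sets borel) (emeasure ?D)"
    using N sets_eq_imp_space_eq[OF N] by simp
  also have "\<dots> = mixture e (density N (\<lambda>x. ennreal (r x))) (density N (\<lambda>x. ennreal (s x)))"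
    unfolding mixture_def
  proof (rule measure_of_eq)
    fix A :: "real set" assume "A \<in> sigma_sets UNIV (sets borel)"
    then have A: "A \<in> sets N"
      using N sets.sigma_sets_eq[of "borel :: real measure"] by simp
    have "emeasure ?D A = (\<integral>\<^sup>+x. ennreal (1 - e) * (ennreal (r x) * indicator A x)
        + ennreal e * (ennreal (s x) * indicator A x) \<partial>N)"
      using A r s e
      by (auto simp: emeasure_density ennreal_mult[symmetric] ennreal_plus[symmetric] distrib_right
          simp del: ennreal_plus intro!: nn_integral_cong split: split_indicator)
    also have "\<dots> = ennreal (1 - e) * emeasure (density N (\<lambda>x. ennreal (r x))) A
        + ennreal e * emeasure (density N (\<lambda>x. ennreal (s x))) A"
      using A r s e by (simp add: emeasure_density nn_integral_add nn_integral_cmult)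
    finally show "emeasure ?D A = \<dots>" .
  qed auto
  finally show ?thesis by simp
qed

text \<open>The pointwise derivative is \<open>1 + ln r\<close>, but both densities have mass 1, so
  the constant contributes nothing against \<nu> - \<rho> and \<open>ln r\<close> remains.
  Positivity of \<open>r\<close> makes \<open>t ln t\<close> differentiable at the base point for
  every competitor, including those that vanish there. Integrability of \<open>ln r\<close> against
  all competitors makes the tangent integrable.\<close>

lemma KL_first_variation:
  fixes N :: "real measure" and r :: "real \<Rightarrow> real"
  assumes N: "prob_space N" "sets N = sets borel"
    and r: "r \<in> borel_measurable borel" "\<And>x. 0 < r x"
    and R: "prob_space (density N (\<lambda>x. ennreal (r x)))"
    and fin: "integrable N (\<lambda>x. r x * ln (r x))"
    and int: "\<And>\<nu>. \<nu> \<in> dom_F (\<lambda>\<mu>. KL \<mu> N) \<Longrightarrow> integrable \<nu> (\<lambda>x. ln (r x))"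
  shows "is_first_variation (\<lambda>\<mu>. KL \<mu> N) (density N (\<lambda>x. ennreal (r x))) (\<lambda>x. ereal (ln (r x)))"
proof -
  interpret N: prob_space N by fact
  let ?R = "density N (\<lambda>x. ennreal (r x))"
  note [measurable_cong] = N(2)
  note [measurable] = r(1)
  have r0: "0 \<le> r x" for x using r(2)[of x] by simp
  have mass: "integrable N w \<and> (\<integral>x. w x \<partial>N) = 1"
    if "prob_space (density N (\<lambda>x. ennreal (w x)))" and w: "w \<in> borel_measurable N" "\<And>x. 0 \<le> w x"
    for w :: "real \<Rightarrow> real"
  proof -
    interpret W: prob_space "density N (\<lambda>x. ennreal (w x))" by fact
    have "(\<integral>\<^sup>+x. ennreal (w x) \<partial>N) = ennreal 1"
      using W.emeasure_space_1 w by (simp add: emeasure_density cong: nn_integral_cong)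
    then show ?thesis
      using w by (subst (asm) nn_integral_eq_integrable) auto
  qed
  have intR: "integrable ?R (\<lambda>x. ln (r x))"
    using fin r0 by (subst integrable_real_density) auto
  have "quasi_integrable \<nu> (\<lambda>x. ereal (ln (r x))) \<and>
    ((\<lambda>\<epsilon>. (KL (mixture \<epsilon> ?R \<nu>) N - KL ?R N) / ereal \<epsilon>)
      \<longlongrightarrow> ext_integral \<nu> (\<lambda>x. ereal (ln (r x))) - ext_integral ?R (\<lambda>x. ereal (ln (r x)))) (at_right 0)"
    if \<nu>: "\<nu> \<in> dom_F (\<lambda>\<mu>. KL \<mu> N)" for \<nu>
  proof
    have \<nu>': "prob_space \<nu>" "sets \<nu> = sets N" "KL \<nu> N < \<infinity>"
      using \<nu> N by (auto simp: dom_F_def P2_def)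
    obtain s where s: "s \<in> borel_measurable N" "\<And>x. 0 \<le> s x"
      "\<nu> = density N (\<lambda>x. ennreal (s x))" "integrable N (\<lambda>x. s x * ln (s x))"
      using KL_finiteE[OF N(1) \<nu>'] by blast
    note [measurable] = s(1)
    note int\<nu> = int[OF \<nu>]
    show "quasi_integrable \<nu> (\<lambda>x. ereal (ln (r x)))"
      using int\<nu> by (auto simp: quasi_integrable_def real_integrable_def less_top)
    define m where "m = (\<lambda>e x. (1 - e) * r x + e * s x)"
    define Q where "Q = (\<lambda>e x. (m e x * ln (m e x) - r x * ln (r x)) / e)"
    define G where "G = (\<lambda>x. (1 + ln (r x)) * (s x - r x))"
    have [measurable]: "m e \<in> borel_measurable N" for e unfolding m_def by measurable
    have [measurable]: "Q e \<in> borel_measurable N" "G \<in> borel_measurable N" for e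
      unfolding Q_def G_def by measurable
    have m0: "0 < m e x" if "e \<in> {0<..<1}" for e x
      unfolding m_def using that r(2)[of x] s(2)[of x] by (intro add_pos_nonneg) auto
    have mr: "m e x - r x = e * (s x - r x)" for e x by (simp add: m_def algebra_simps)
    have upper: "Q e x \<le> s x * ln (s x) - r x * ln (r x)" if "e \<in> {0<..<1}" for e x
    proof -
      have "m e x * ln (m e x) - r x * ln (r x) \<le> e * (s x * ln (s x) - r x * ln (r x))"
        using xlnx_convex[OF r(2)[of x] s(2)[of x], of e] that unfolding m_def by (simp add: algebra_simps)
      then show ?thesis using that by (simp add: Q_def field_simps)
    qed
    have lower: "G x \<le> Q e x" if "e \<in> {0<..<1}" for e x
    proof -
      have "(1 + ln (r x)) * (m e x - r x) \<le> m e x * ln (m e x) - r x * ln (r x)"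
        using xlnx_tangent[OF r(2)[of x], of "m e x"] m0[OF that, of x] by simp
      then show ?thesis using that unfolding mr by (simp add: Q_def G_def field_simps)
    qed
    have ms: "integrable N s" "(\<integral>x. s x \<partial>N) = 1" and mr1: "integrable N r" "(\<integral>x. r x \<partial>N) = 1"
      using mass[of s] mass[of r] s \<nu>'(1) R r0 by auto
    have ls: "integrable N (\<lambda>x. s x * ln (r x))"
      using int\<nu> s unfolding s(3) by (subst (asm) integrable_real_density) auto
    have G_eq: "G x = s x - r x + s x * ln (r x) - r x * ln (r x)" for x
      by (simp add: G_def algebra_simps)
    have intG: "integrable N G"
      unfolding G_eq[abs_def] using ms mr1 ls fin by auto
    have G_val: "(\<integral>x. G x \<partial>N) = (\<integral>x. ln (r x) \<partial>\<nu>) - (\<integral>x. ln (r x) \<partial>?R)"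
      using ms mr1 ls fin s r0 unfolding G_eq[abs_def] s(3)
      by (simp add: integral_real_density)
    \<comment> \<open>A function between the tangent and the chord is at most the sum of their
      absolute values. This bound does not depend on \<open>e\<close>, so it dominates all
      difference quotients.\<close>
    define B where "B = (\<lambda>x. \<bar>G x\<bar> + \<bar>s x * ln (s x) - r x * ln (r x)\<bar>)"
    have intB: "integrable N B"
      unfolding B_def using intG s(4) fin by auto
    have bound: "\<bar>Q e x\<bar> \<le> B x" if "e \<in> {0<..<1}" for e x
      using upper[OF that, of x] lower[OF that, of x] unfolding B_def by linarith
    have intQ: "integrable N (Q e)" if "e \<in> {0<..<1}" for e
      by (rule Bochner_Integration.integrable_bound[OF intB]) (use order_trans[OF bound[OF that] abs_ge_self] in auto)
    have quot: "(KL (mixture e ?R \<nu>) N - KL ?R N) / ereal e = ereal (\<integral>x. Q e x \<partial>N)"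
      if e: "e \<in> {0<..<1}" for e
    proof -
      have eq: "m e x * ln (m e x) = e * Q e x + r x * ln (r x)" for x
        using e by (simp add: Q_def)
      have "mixture e ?R \<nu> = density N (\<lambda>x. ennreal (m e x))"
        unfolding s(3) m_def using e N s r0 by (intro mixture_density) auto
      moreover have "integrable N (\<lambda>x. m e x * ln (m e x))"
        unfolding eq using intQ[OF e] fin by auto
      ultimately have "KL (mixture e ?R \<nu>) N = ereal (\<integral>x. m e x * ln (m e x) \<partial>N)"
        using KL_density[OF N(1), of "m e"] m0[OF e] by (auto simp: less_imp_le)
      also have "(\<integral>x. m e x * ln (m e x) \<partial>N) = e * (\<integral>x. Q e x \<partial>N) + (\<integral>x. r x * ln (r x) \<partial>N)"
        unfolding eq using intQ[OF e] fin by simp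
      finally show ?thesis
        using KL_density[OF N(1), of r] r0 fin e by simp
    qed
    have lim: "((\<lambda>e. \<integral>x. Q e x \<partial>N) \<longlongrightarrow> (\<integral>x. G x \<partial>N)) (at_right 0)"
    proof -
      have "((\<lambda>e. \<integral>x. Q e x \<partial>N) \<longlongrightarrow> (\<integral>x. G x \<partial>N)) (at 0 within {0<..<1})"
        \<comment> \<open>Dominated convergence speaks of sequences, so the one-sided limit is
          tested along arbitrary sequences in the open unit interval.\<close>
        unfolding tendsto_at_iff_sequentially comp_def
      proof (intro allI impI)
        fix X :: "nat \<Rightarrow> real" assume X: "\<forall>i. X i \<in> {0<..<1} - {0}" "X \<longlonglongrightarrow> 0"
        show "(\<lambda>i. \<integral>x. Q (X i) x \<partial>N) \<longlonglongrightarrow> (\<integral>x. G x \<partial>N)"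
        proof (rule integral_dominated_convergence[OF _ _ intB])
          show "AE x in N. (\<lambda>i. Q (X i) x) \<longlonglongrightarrow> G x"
          proof (rule AE_I2)
            fix x
            \<comment> \<open>At \<open>e = 0\<close> the mixture density equals
              \<open>r x > 0\<close>, where the logarithm is smooth; \<open>Q e x\<close> is the
              difference quotient of this function.\<close>
            have "((\<lambda>e. m e x * ln (m e x)) has_real_derivative G x) (at 0)"
              unfolding m_def G_def using r(2)[of x]
              by (auto intro!: derivative_eq_intros simp: algebra_simps)
            then have "((\<lambda>e. Q e x) \<longlongrightarrow> G x) (at 0)"
              by (simp add: has_field_derivative_iff Q_def m_def)
            moreover have "filterlim X (at 0) sequentially"
              using X unfolding filterlim_at by (auto intro!: always_eventually simp: less_imp_neq[symmetric])
            ultimately show "(\<lambda>i. Q (X i) x) \<longlonglongrightarrow> G x"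
              by (rule filterlim_compose)
          qed
          show "AE x in N. norm (Q (X i) x) \<le> B x" for i
            using bound[of "X i"] X by auto
        qed auto
      qed
      moreover have "at 0 within {0<..<1} = at_right (0::real)"
        by (rule at_within_nhd[of _ "{-1<..<1}"]) auto
      ultimately show ?thesis by simp
    qed
    have "((\<lambda>e. ereal (\<integral>x. Q e x \<partial>N)) \<longlongrightarrow> ereal (\<integral>x. G x \<partial>N)) (at_right 0)"
      using lim by simp
    moreover have "\<forall>\<^sub>F e in at_right 0. ereal (\<integral>x. Q e x \<partial>N) = (KL (mixture e ?R \<nu>) N - KL ?R N) / ereal e"
      using eventually_at_right_real[of 0 1] by (auto elim!: eventually_mono simp: quot)
    ultimately have "((\<lambda>\<epsilon>. (KL (mixture \<epsilon> ?R \<nu>) N - KL ?R N) / ereal \<epsilon>) \<longlongrightarrow> ereal (\<integral>x. G x \<partial>N)) (at_right 0)"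
      by (rule Lim_transform_eventually)
    then show "((\<lambda>\<epsilon>. (KL (mixture \<epsilon> ?R \<nu>) N - KL ?R N) / ereal \<epsilon>)
      \<longlongrightarrow> ext_integral \<nu> (\<lambda>x. ereal (ln (r x))) - ext_integral ?R (\<lambda>x. ereal (ln (r x)))) (at_right 0)"
      by (simp add: G_val ext_integral_ereal[OF int\<nu>] ext_integral_ereal[OF intR])
  qed
  moreover have "(\<integral>\<^sup>+x. e2ennreal \<bar>ereal (ln (r x))\<bar> \<partial>?R) < \<infinity>"
    using intR by (simp add: integrable_iff_bounded)
  ultimately show ?thesis
    unfolding is_first_variation_def by auto
qed

subsection \<open>Wasserstein gradients\<close>

lemma borel_measurable_fst_snd_prod [measurable]:
  "fst \<in> borel_measurable (borel :: (real \<times> real) measure)"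
  "snd \<in> borel_measurable (borel :: (real \<times> real) measure)"
  by (simp_all add: borel_prod[symmetric])

lemma W2_le:
  assumes "\<pi> \<in> couplings \<mu> \<nu>" and "transport_cost \<pi> \<le> ennreal c" and "0 \<le> c"
  shows "W2 \<mu> \<nu> \<le> sqrt c"
proof -
  have "(INF \<pi>\<in>couplings \<mu> \<nu>. transport_cost \<pi>) \<le> ennreal c"
    using assms by (meson INF_lower order_trans)
  then have "enn2real (INF \<pi>\<in>couplings \<mu> \<nu>. transport_cost \<pi>) \<le> c"
    using assms(3) enn2real_leI by blast
  then show ?thesis by (simp add: W2_def)
qed

lemma optimal_plans_W2:
  assumes "\<pi> \<in> optimal_plans \<mu> \<nu>"
  shows "W2 \<mu> \<nu> = sqrt (enn2real (transport_cost \<pi>))"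
proof -
  have "(INF \<pi>\<in>couplings \<mu> \<nu>. transport_cost \<pi>) = transport_cost \<pi>"
    using assms by (intro antisym INF_lower INF_greatest) (auto simp: optimal_plans_def)
  then show ?thesis by (simp add: W2_def)
qed

lemma couplings_nn_integral:
  assumes "\<pi> \<in> couplings \<mu> \<nu>" and "f \<in> borel_measurable borel"
  shows "(\<integral>\<^sup>+z. f (fst z) \<partial>\<pi>) = (\<integral>\<^sup>+x. f x \<partial>\<mu>)" "(\<integral>\<^sup>+z. f (snd z) \<partial>\<pi>) = (\<integral>\<^sup>+x. f x \<partial>\<nu>)"
proof -
  have [measurable_cong]: "sets \<pi> = sets borel"
    and \<mu>: "\<mu> = distr \<pi> borel fst" and \<nu>: "\<nu> = distr \<pi> borel snd"
    using assms by (auto simp: couplings_def)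
  show "(\<integral>\<^sup>+z. f (fst z) \<partial>\<pi>) = (\<integral>\<^sup>+x. f x \<partial>\<mu>)" "(\<integral>\<^sup>+z. f (snd z) \<partial>\<pi>) = (\<integral>\<^sup>+x. f x \<partial>\<nu>)"
    using assms(2) unfolding \<mu> \<nu> by (auto simp: nn_integral_distr)
qed

lemma transport_cost_finite:
  assumes \<pi>: "\<pi> \<in> couplings \<mu> \<nu>" and "\<mu> \<in> P2" "\<nu> \<in> P2"
  shows "transport_cost \<pi> < \<infinity>"
proof -
  have [measurable_cong]: "sets \<pi> = sets borel" using \<pi> by (auto simp: couplings_def)
  have "transport_cost \<pi> \<le> (\<integral>\<^sup>+z. ennreal 2 * ennreal ((fst z)\<^sup>2) + ennreal 2 * ennreal ((snd z)\<^sup>2) \<partial>\<pi>)"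
    unfolding transport_cost_def
  proof (intro nn_integral_mono)
    fix z :: "real \<times> real"
    have "(fst z - snd z)\<^sup>2 \<le> 2 * (fst z)\<^sup>2 + 2 * (snd z)\<^sup>2"
      using zero_le_power2[of "fst z + snd z"] by (simp add: power2_eq_square algebra_simps)
    then show "ennreal ((fst z - snd z)\<^sup>2) \<le> ennreal 2 * ennreal ((fst z)\<^sup>2) + ennreal 2 * ennreal ((snd z)\<^sup>2)"
      by (subst (1 2) ennreal_mult[symmetric]) (auto simp: ennreal_plus[symmetric] ennreal_leI simp del: ennreal_plus)
  qed
  also have "\<dots> = ennreal 2 * (\<integral>\<^sup>+x. ennreal (x\<^sup>2) \<partial>\<mu>) + ennreal 2 * (\<integral>\<^sup>+x. ennreal (x\<^sup>2) \<partial>\<nu>)"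
    using couplings_nn_integral[OF \<pi>, of "\<lambda>x. ennreal (x\<^sup>2)"]
    by (simp add: nn_integral_add nn_integral_cmult)
  also have "\<dots> < \<infinity>"
    using assms by (auto simp: P2_def ennreal_mult_less_top)
  finally show ?thesis .
qed

text \<open>Taking \<open>e = 1\<close> bounds the remainder by \<open>W2\<close>. The linear term
  is also of order \<open>W2\<close>: the displacement along an optimal plan has mean square exactly
  \<open>W2\<close> squared, and \<xi> is square integrable. Differentiability thus forces a finite
  slope at \<rho>, the property that a jump will violate.\<close>

lemma W_gradient_bound:
  assumes \<xi>: "\<xi> \<in> W_gradients F \<rho>" and \<rho>: "\<rho> \<in> P2"
  obtains C d where "0 < d"
    "\<And>\<nu>. \<nu> \<in> dom_F F \<Longrightarrow> W2 \<rho> \<nu> < d \<Longrightarrow>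
       \<bar>real_of_ereal (F \<nu>) - real_of_ereal (F \<rho>)\<bar> \<le> C * W2 \<rho> \<nu>"
proof -
  have [measurable]: "\<xi> \<in> borel_measurable borel" and int\<xi>: "integrable \<rho> (\<lambda>x. (\<xi> x)\<^sup>2)"
    using \<xi> by (auto simp: W_gradients_def)
  obtain \<pi> where \<pi>: "\<And>\<nu>. \<nu> \<in> dom_F F \<Longrightarrow> \<pi> \<nu> \<in> optimal_plans \<rho> \<nu>"
    and dif: "\<And>e. 0 < e \<Longrightarrow> \<exists>d>0. \<forall>\<nu>\<in>dom_F F. W2 \<rho> \<nu> < d \<longrightarrow>
              \<bar>real_of_ereal (F \<nu>) - real_of_ereal (F \<rho>)
                 - (\<integral>z. \<xi> (fst z) * (snd z - fst z) \<partial>\<pi> \<nu>)\<bar> \<le> e * W2 \<rho> \<nu>"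
    using \<xi> by (auto simp: W_gradients_def)
  obtain d where d: "0 < d" "\<And>\<nu>. \<nu> \<in> dom_F F \<Longrightarrow> W2 \<rho> \<nu> < d \<Longrightarrow>
       \<bar>real_of_ereal (F \<nu>) - real_of_ereal (F \<rho>)
                 - (\<integral>z. \<xi> (fst z) * (snd z - fst z) \<partial>\<pi> \<nu>)\<bar> \<le> 1 * W2 \<rho> \<nu>"
    using dif[of 1] by auto
  let ?X = "\<integral>x. (\<xi> x)\<^sup>2 \<partial>\<rho>"
  have key: "\<bar>\<integral>z. \<xi> (fst z) * (snd z - fst z) \<partial>\<pi> \<nu>\<bar> \<le> ((?X + 1) / 2) * W2 \<rho> \<nu>"
    if \<nu>: "\<nu> \<in> dom_F F" for \<nu>
  proof -
    let ?w = "W2 \<rho> \<nu>"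
    have c: "\<pi> \<nu> \<in> couplings \<rho> \<nu>" using \<pi>[OF \<nu>] by (auto simp: optimal_plans_def)
    have s[measurable_cong]: "sets (\<pi> \<nu>) = sets borel" and fst: "distr (\<pi> \<nu>) borel fst = \<rho>"
      using c by (auto simp: couplings_def)
    have "transport_cost (\<pi> \<nu>) < \<infinity>"
      using transport_cost_finite[OF c \<rho>] \<nu> by (auto simp: dom_F_def)
    then have intD: "integrable (\<pi> \<nu>) (\<lambda>z. (snd z - fst z)\<^sup>2)"
      by (simp add: integrable_iff_bounded transport_cost_def power2_commute)
    have D: "(\<integral>z. (snd z - fst z)\<^sup>2 \<partial>\<pi> \<nu>) = ?w\<^sup>2"
      unfolding optimal_plans_W2[OF \<pi>[OF \<nu>]]
      by (simp add: integral_eq_nn_integral transport_cost_def power2_commute)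
    have intX: "integrable (\<pi> \<nu>) (\<lambda>z. (\<xi> (fst z))\<^sup>2)"
      using int\<xi> unfolding fst[symmetric] by (subst (asm) integrable_distr_eq) auto
    have X: "(\<integral>z. (\<xi> (fst z))\<^sup>2 \<partial>\<pi> \<nu>) = ?X"
      unfolding fst[symmetric] by (subst integral_distr) auto
    have w0: "0 \<le> ?w" by (simp add: W2_def)
    \<comment> \<open>Distance 0 is treated apart because the weights below divide by it; the plan
      then lives on the diagonal and the linear term vanishes.\<close>
    show ?thesis
    proof (cases "?w = 0")
      case True
      then have "AE z in \<pi> \<nu>. (snd z - fst z)\<^sup>2 = 0"
        using integral_nonneg_eq_0_iff_AE[OF intD] D by simp
      then have "(\<integral>z. \<xi> (fst z) * (snd z - fst z) \<partial>\<pi> \<nu>) = (\<integral>z. 0 \<partial>\<pi> \<nu>)"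
        by (intro integral_cong_AE) (auto elim!: eventually_mono)
      then show ?thesis using True by simp
    next
      case False
      then have w: "0 < ?w" using w0 by simp
      \<comment> \<open>Young's inequality with weights tuned to the distance, in place of
        Cauchy-Schwarz: both summands integrate to a multiple of \<open>W2\<close>, at the price of
        \<open>(?X + 1) / 2\<close> instead of the square root of \<open>?X\<close>.\<close>
      let ?B = "\<lambda>z. (?w / 2) * (\<xi> (fst z))\<^sup>2 + (1 / (2 * ?w)) * (snd z - fst z)\<^sup>2"
      have amgm: "\<bar>\<xi> (fst z) * (snd z - fst z)\<bar> \<le> ?B z" for z
      proof -
        have *: "?B z - a * b = (?w * a - b)\<^sup>2 / (2 * ?w)"
          if "a\<^sup>2 = (\<xi> (fst z))\<^sup>2" "b\<^sup>2 = (snd z - fst z)\<^sup>2" for a b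
          using w unfolding that[symmetric] by (simp add: field_simps power2_eq_square)
        have "0 \<le> ?B z - \<bar>\<xi> (fst z)\<bar> * \<bar>snd z - fst z\<bar>"
          using w by (subst *) auto
        then show ?thesis by (simp add: abs_mult)
      qed
      have intB: "integrable (\<pi> \<nu>) ?B"
        using intX intD by auto
      have "\<bar>\<integral>z. \<xi> (fst z) * (snd z - fst z) \<partial>\<pi> \<nu>\<bar> \<le> (\<integral>z. ?B z \<partial>\<pi> \<nu>)"
        using integral_abs_bound_integral[of "\<pi> \<nu>" "\<lambda>z. \<xi> (fst z) * (snd z - fst z)" ?B] intB amgm
        by (smt (verit) Bochner_Integration.integrable_bound AE_I2 integral_norm_bound_integral not_integrable_integral_eq integral_nonneg_AE real_norm_def)
      also have "\<dots> = (?w / 2) * ?X + (1 / (2 * ?w)) * ?w\<^sup>2"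
        using intX intD by (simp add: X D)
      also have "\<dots> = ((?X + 1) / 2) * ?w"
        using w by (simp add: field_simps power2_eq_square)
      finally show ?thesis .
    qed
  qed
  show ?thesis
  proof (rule that[of d "(?X + 1) / 2 + 1"])
    show "0 < d" by fact
    fix \<nu> assume \<nu>: "\<nu> \<in> dom_F F" "W2 \<rho> \<nu> < d"
    show "\<bar>real_of_ereal (F \<nu>) - real_of_ereal (F \<rho>)\<bar> \<le> ((?X + 1) / 2 + 1) * W2 \<rho> \<nu>"
      using d(2)[OF \<nu>] key[OF \<nu>(1)] by (simp only: distrib_right mult_1)
  qed
qed

section \<open>Moving mass across a jump\<close>

text \<open>One explicit plan, optimal or not, suffices to bound \<open>W2\<close> from above. The
  part \<open>k\<close> is displaced from \<open>x\<close> to \<open>x - \<delta>\<close>, the rest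
  stays put at no cost.\<close>

lemma shift_coupling:
  fixes f k :: "real \<Rightarrow> real" and \<delta> :: real
  assumes [measurable]: "f \<in> borel_measurable borel" "k \<in> borel_measurable borel"
    and k: "\<And>x. 0 \<le> k x" "\<And>x. k x \<le> f x"
  obtains \<pi> where
    "\<pi> \<in> couplings (density lborel (\<lambda>x. ennreal (f x)))
       (density lborel (\<lambda>x. ennreal (f x - k x + k (x + \<delta>))))"
    "transport_cost \<pi> = (\<integral>\<^sup>+x. ennreal (k x * \<delta>\<^sup>2) \<partial>lborel)"
proof -
  \<comment> \<open>The Boolean coordinate splits the mass: \<open>True\<close> marks the part \<open>k\<close> that is shifted by \<open>\<delta>\<close>.\<close>
  let ?B = "count_space (UNIV :: bool set)"
  let ?w = "\<lambda>(x, b). ennreal (if b then k x else f x - k x)"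
  let ?T = "\<lambda>(x, b). (x, if b then x - \<delta> else x)"
  interpret B: sigma_finite_measure ?B
    by (rule sigma_finite_measure_count_space_finite) simp
  have T[measurable]: "?T \<in> measurable (lborel \<Otimes>\<^sub>M ?B) (borel :: (real \<times> real) measure)"
    unfolding borel_prod[symmetric] by measurable
  define \<pi> where "\<pi> = distr (density (lborel \<Otimes>\<^sub>M ?B) ?w) borel ?T"
  have [measurable_cong]: "sets \<pi> = sets borel" by (simp add: \<pi>_def)
  have int: "(\<integral>\<^sup>+z. G z \<partial>\<pi>) = (\<integral>\<^sup>+x. ennreal (f x - k x) * G (x, x) \<partial>lborel) + (\<integral>\<^sup>+x. ennreal (k x) * G (x, x - \<delta>) \<partial>lborel)"
    if [measurable]: "G \<in> borel_measurable borel" for G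
  proof -
    have [measurable]: "(\<lambda>x. G (x, x)) \<in> borel_measurable borel" "(\<lambda>x. G (x, x - \<delta>)) \<in> borel_measurable borel"
      by (auto intro!: measurable_compose[OF _ that] simp: borel_prod[symmetric])
    have "(\<integral>\<^sup>+z. G z \<partial>\<pi>) = (\<integral>\<^sup>+z. ?w z * G (?T z) \<partial>(lborel \<Otimes>\<^sub>M ?B))"
      unfolding \<pi>_def by (subst nn_integral_distr) (auto simp: nn_integral_density)
    also have "\<dots> = (\<integral>\<^sup>+x. \<integral>\<^sup>+b. ?w (x, b) * G (?T (x, b)) \<partial>?B \<partial>lborel)"
      by (rule B.nn_integral_fst[symmetric]) measurable
    also have "\<dots> = (\<integral>\<^sup>+x. ennreal (f x - k x) * G (x, x) + ennreal (k x) * G (x, x - \<delta>) \<partial>lborel)"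
      by (intro nn_integral_cong) (simp add: nn_integral_count_space_finite UNIV_bool)
    also have "\<dots> = (\<integral>\<^sup>+x. ennreal (f x - k x) * G (x, x) \<partial>lborel) + (\<integral>\<^sup>+x. ennreal (k x) * G (x, x - \<delta>) \<partial>lborel)"
      by (rule nn_integral_add) auto
    finally show ?thesis .
  qed
  have "distr \<pi> borel fst = density lborel (\<lambda>x. ennreal (f x))"
  proof (rule measure_eqI)
    fix A assume "A \<in> sets (distr \<pi> borel fst)"
    then have A[measurable]: "A \<in> sets borel" by simp
    have [measurable]: "(\<lambda>z. indicator A (fst z) :: ennreal) \<in> borel_measurable (borel :: (real \<times> real) measure)"
      by (auto intro!: measurable_compose[OF _ borel_measurable_indicator[OF A]])
    have "emeasure (distr \<pi> borel fst) A = (\<integral>\<^sup>+x. indicator A x \<partial>distr \<pi> borel fst)" by simp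
    also have "\<dots> = (\<integral>\<^sup>+z. indicator A (fst z) \<partial>\<pi>)"
      by (rule nn_integral_distr) measurable
    also have "\<dots> = (\<integral>\<^sup>+x. ennreal (f x - k x) * indicator A x + ennreal (k x) * indicator A x \<partial>lborel)"
      by (subst int) (auto simp: nn_integral_add)
    also have "\<dots> = (\<integral>\<^sup>+x. ennreal (f x) * indicator A x \<partial>lborel)"
      using k by (intro nn_integral_cong)
        (auto simp: ennreal_plus[symmetric] simp del: ennreal_plus split: split_indicator)
    finally show "emeasure (distr \<pi> borel fst) A = emeasure (density lborel (\<lambda>x. ennreal (f x))) A"
      by (simp add: emeasure_density)
  qed simp
  moreover have "distr \<pi> borel snd = density lborel (\<lambda>x. ennreal (f x - k x + k (x + \<delta>)))"
  proof (rule measure_eqI)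
    fix A assume "A \<in> sets (distr \<pi> borel snd)"
    then have A[measurable]: "A \<in> sets borel" by simp
    have [measurable]: "(\<lambda>z. indicator A (snd z) :: ennreal) \<in> borel_measurable (borel :: (real \<times> real) measure)"
      by (auto intro!: measurable_compose[OF _ borel_measurable_indicator[OF A]])
    have "(\<integral>\<^sup>+x. ennreal (k x) * indicator A (x - \<delta>) \<partial>lborel) = (\<integral>\<^sup>+x. ennreal (k (x + \<delta>)) * indicator A x \<partial>lborel)"
      by (subst nn_integral_real_affine[where c = 1 and t = \<delta>]) (auto simp: add.commute)
    note shift = this
    have "emeasure (distr \<pi> borel snd) A = (\<integral>\<^sup>+x. indicator A x \<partial>distr \<pi> borel snd)" by simp
    also have "\<dots> = (\<integral>\<^sup>+z. indicator A (snd z) \<partial>\<pi>)"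
      by (rule nn_integral_distr) measurable
    also have "\<dots> = (\<integral>\<^sup>+x. ennreal (f x - k x) * indicator A x + ennreal (k (x + \<delta>)) * indicator A x \<partial>lborel)"
      by (subst int) (auto simp: nn_integral_add shift)
    also have "\<dots> = (\<integral>\<^sup>+x. ennreal (f x - k x + k (x + \<delta>)) * indicator A x \<partial>lborel)"
      using k by (intro nn_integral_cong)
        (auto simp: ennreal_plus[symmetric] simp del: ennreal_plus split: split_indicator)
    finally show "emeasure (distr \<pi> borel snd) A = emeasure (density lborel (\<lambda>x. ennreal (f x - k x + k (x + \<delta>)))) A"
      by (simp add: emeasure_density)
  qed simp
  moreover have "transport_cost \<pi> = (\<integral>\<^sup>+x. ennreal (k x * \<delta>\<^sup>2) \<partial>lborel)"
    unfolding transport_cost_def using k by (subst int) (auto simp: ennreal_mult)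
  ultimately show ?thesis using that[of \<pi>] by (auto simp: couplings_def \<pi>_def)
qed

text \<open>The logarithm of the relative density \<open>f exp U\<close> is \<open>ln f + U\<close>,
  which turns the divergence into a Lebesgue integral in which two densities can be subtracted
  pointwise.\<close>

lemma KL_gibbs:
  fixes f U :: "real \<Rightarrow> real"
  assumes N: "prob_space N" "N = density lborel (\<lambda>x. ennreal (exp (- U x)))"
    and [measurable]: "U \<in> borel_measurable borel" "f \<in> borel_measurable borel"
    and pos: "\<And>x. 0 < f x"
    and int: "integrable lborel (\<lambda>x. f x * (ln (f x) + U x))"
  defines "r \<equiv> (\<lambda>x. f x * exp (U x))"
  shows "density lborel (\<lambda>x. ennreal (f x)) = density N (\<lambda>x. ennreal (r x))"
    and "integrable N (\<lambda>x. r x * ln (r x))"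
    and "KL (density lborel (\<lambda>x. ennreal (f x))) N = ereal (\<integral>x. f x * (ln (f x) + U x) \<partial>lborel)"
proof -
  have f0: "0 \<le> f x" for x using pos[of x] by simp
  have [measurable]: "r \<in> borel_measurable borel" unfolding r_def by measurable
  have eq: "exp (- U x) * (r x * ln (r x)) = f x * (ln (f x) + U x)" for x
  proof -
    have "exp (- U x) * r x = f x"
      unfolding r_def by (metis exp_minus_inverse mult.assoc mult.commute mult_1)
    moreover have "ln (r x) = ln (f x) + U x"
      using pos[of x] by (simp add: r_def ln_mult)
    ultimately show ?thesis by (metis mult.assoc)
  qed
  show dens: "density lborel (\<lambda>x. ennreal (f x)) = density N (\<lambda>x. ennreal (r x))"
    unfolding N(2) using f0
    by (subst density_density_eq)
      (auto simp: r_def ennreal_mult[symmetric] exp_minus field_simps intro!: density_cong)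
  show fin: "integrable N (\<lambda>x. r x * ln (r x))"
    unfolding N(2) using int by (subst integrable_real_density) (auto simp: eq)
  have "KL (density N (\<lambda>x. ennreal (r x))) N = ereal (\<integral>x. r x * ln (r x) \<partial>N)"
    using f0 by (intro KL_density[OF N(1) _ _ fin]) (auto simp: r_def N(2))
  also have "(\<integral>x. r x * ln (r x) \<partial>N) = (\<integral>x. f x * (ln (f x) + U x) \<partial>lborel)"
    unfolding N(2) by (subst integral_real_density) (auto simp: eq)
  finally show "KL (density lborel (\<lambda>x. ennreal (f x))) N = ereal (\<integral>x. f x * (ln (f x) + U x) \<partial>lborel)"
    unfolding dens .
qed

text \<open>Moving a layer of height \<open>s\<close> and width \<open>\<delta>\<close> across the jump by the distance \<open>\<delta>\<close> lowers the
  divergence by an amount of order \<open>\<delta>\<close>, whereas the distance covered in \<open>W2\<close> is of order \<open>\<delta> powr (3 / 2)\<close>.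
  Hence the slope is infinite, which contradicts \<open>W_gradient_bound\<close>.\<close>

lemma jump_not_in_S_W:
  fixes f U :: "real \<Rightarrow> real"
  assumes N: "prob_space N" "N = density lborel (\<lambda>x. ennreal (exp (- U x)))"
    and [measurable]: "U \<in> borel_measurable borel" "f \<in> borel_measurable borel"
    and U: "isCont U x0"
    and pos: "\<And>x. 0 < f x"
    and int: "integrable lborel (\<lambda>x. f x * (ln (f x) + U x))"
    and P2: "density lborel (\<lambda>x. ennreal (f x)) \<in> P2"
    and left: "(f \<longlongrightarrow> p) (at_left x0)" and right: "(f \<longlongrightarrow> q) (at_right x0)"
    and pq: "0 < p" "p < q"
  shows "density lborel (\<lambda>x. ennreal (f x)) \<notin> S_W (\<lambda>\<mu>. KL \<mu> N)"
proof
  let ?R = "density lborel (\<lambda>x. ennreal (f x))" and ?F = "\<lambda>\<mu>. KL \<mu> N"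
  assume "?R \<in> S_W ?F"
  then obtain \<xi> where "\<xi> \<in> W_gradients ?F ?R" by (auto simp: S_W_def)
  then obtain C d where d: "0 < d" and slope: "\<And>\<nu>. \<nu> \<in> dom_F ?F \<Longrightarrow> W2 ?R \<nu> < d \<Longrightarrow>
       \<bar>real_of_ereal (?F \<nu>) - real_of_ereal (?F ?R)\<bar> \<le> C * W2 ?R \<nu>"
    using W_gradient_bound[OF _ P2] by metis
  have f0: "0 \<le> f x" for x using pos[of x] by simp
  have R: "prob_space ?R" using P2 by (simp add: P2_def)
  interpret R: prob_space ?R by fact
  \<comment> \<open>The jump is cut into five equal levels: near \<open>x0\<close> the left values
    stay below \<open>p + s\<close> and the right values above \<open>p + 4 * s\<close>. After a
    layer of height \<open>s\<close> has moved, the values on the receiving side are below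
    \<open>p + 2 * s\<close> and those on the giving side above \<open>p + 3 * s\<close>, so a whole
    level still separates them.\<close>
  define s where "s = (q - p) / 5"
  have s: "0 < s" and q: "q = p + 5 * s" using pq by (simp_all add: s_def field_simps)
  \<comment> \<open>The surviving level is worth \<open>4 * \<eta>\<close> in the logarithm. The
    oscillation of \<open>U\<close> costs at most \<eta> on each side, which leaves
    \<open>2 * \<eta>\<close> per unit of moved mass.\<close>
  define \<eta> where "\<eta> = (ln (p + 3 * s) - ln (p + 2 * s)) / 4"
  have \<eta>: "0 < \<eta>" using pq s by (simp add: \<eta>_def)
  have "\<forall>\<^sub>F x in at_left x0. p / 2 < f x \<and> f x < p + s \<and> \<bar>U x - U x0\<bar> < \<eta>"
  proof (intro eventually_conj)
    show "\<forall>\<^sub>F x in at_left x0. p / 2 < f x"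
      by (rule order_tendstoD(1)[OF left]) (use pq in simp)
    show "\<forall>\<^sub>F x in at_left x0. f x < p + s"
      by (rule order_tendstoD(2)[OF left]) (use s in simp)
    have "(U \<longlongrightarrow> U x0) (at_left x0)"
      using U by (simp add: isCont_def filterlim_at_split)
    then show "\<forall>\<^sub>F x in at_left x0. \<bar>U x - U x0\<bar> < \<eta>"
      using tendstoD[OF _ \<eta>, of U "U x0"] by (simp add: dist_real_def)
  qed
  then obtain l where l: "l < x0" "\<And>x. l < x \<Longrightarrow> x < x0 \<Longrightarrow> p / 2 < f x \<and> f x < p + s \<and> \<bar>U x - U x0\<bar> < \<eta>"
    unfolding eventually_at_left_field by blast
  have "\<forall>\<^sub>F x in at_right x0. q - s < f x \<and> \<bar>U x - U x0\<bar> < \<eta>"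
  proof (intro eventually_conj)
    show "\<forall>\<^sub>F x in at_right x0. q - s < f x"
      using right s by (auto intro: order_tendstoD)
    have "(U \<longlongrightarrow> U x0) (at_right x0)"
      using U by (simp add: isCont_def filterlim_at_split)
    then show "\<forall>\<^sub>F x in at_right x0. \<bar>U x - U x0\<bar> < \<eta>"
      using tendstoD[OF _ \<eta>, of U "U x0"] by (simp add: dist_real_def)
  qed
  then obtain u where u: "x0 < u" "\<And>x. x0 < x \<Longrightarrow> x < u \<Longrightarrow> q - s < f x \<and> \<bar>U x - U x0\<bar> < \<eta>"
    unfolding eventually_at_right_field by blast
  \<comment> \<open>The first smallness condition brings the perturbed measure within the radius of
    the slope bound; the second makes \<open>C\<close> times the distance smaller than the drop
    \<open>2 * \<eta> * s * \<delta>\<close>.\<close>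
  have "((\<lambda>\<delta>. \<delta> * sqrt (s * \<delta>)) \<longlongrightarrow> 0 * sqrt (s * 0)) (at_right 0)"
    "((\<lambda>\<delta>. C * sqrt (s * \<delta>)) \<longlongrightarrow> C * sqrt (s * 0)) (at_right 0)"
    by (intro tendsto_intros)+
  then have "\<forall>\<^sub>F \<delta> in at_right 0. \<delta> * sqrt (s * \<delta>) < d"
    "\<forall>\<^sub>F \<delta> in at_right 0. C * sqrt (s * \<delta>) < 2 * \<eta> * s"
    using d \<eta> s by (auto intro: order_tendstoD)
  moreover have "\<forall>\<^sub>F \<delta> in at_right 0. \<delta> \<in> {0<..<min (x0 - l) (u - x0)}"
    by (rule eventually_at_right_real) (use l(1) u(1) in auto)
  ultimately have "\<forall>\<^sub>F \<delta> in at_right 0. \<delta> * sqrt (s * \<delta>) < d \<and> C * sqrt (s * \<delta>) < 2 * \<eta> * s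
      \<and> \<delta> \<in> {0<..<min (x0 - l) (u - x0)}"
    by eventually_elim auto
  then obtain \<delta> where \<delta>: "\<delta> * sqrt (s * \<delta>) < d" "C * sqrt (s * \<delta>) < 2 * \<eta> * s"
    "0 < \<delta>" "\<delta> < x0 - l" "\<delta> < u - x0"
    using eventually_happens'[OF trivial_limit_at_right_real] by fastforce
  define k where "k x = s * indicator {x0<..<x0 + \<delta>} x" for x :: real
  define g where "g x = f x - k x + k (x + \<delta>)" for x
  have [measurable]: "k \<in> borel_measurable borel" unfolding k_def by measurable
  have [measurable]: "g \<in> borel_measurable borel" unfolding g_def by measurable
  have k': "k (x + \<delta>) = s * indicator {x0 - \<delta><..<x0} x" for x
    by (auto simp: k_def split: split_indicator)
  have R_bd: "p + 4 * s < f x \<and> \<bar>U x - U x0\<bar> < \<eta>" if "x \<in> {x0<..<x0 + \<delta>}" for x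
    using u(2)[of x] that \<delta> q by auto
  have L_bd: "p / 2 < f x \<and> f x < p + s \<and> \<bar>U x - U x0\<bar> < \<eta>" if "x \<in> {x0 - \<delta><..<x0}" for x
    using l(2)[of x] that \<delta> by auto
  have kf: "0 \<le> k x \<and> k x \<le> f x / 2" for x
    using R_bd[of x] pq s pos[of x] by (auto simp: k_def split: split_indicator)
  obtain \<pi> where \<pi>: "\<pi> \<in> couplings ?R (density lborel (\<lambda>x. ennreal (g x)))"
    "transport_cost \<pi> = (\<integral>\<^sup>+x. ennreal (k x * \<delta>\<^sup>2) \<partial>lborel)"
    using shift_coupling[of f k \<delta>] kf f0 unfolding g_def by (smt (verit) field_sum_of_halves \<open>f \<in> borel_measurable borel\<close> \<open>k \<in> borel_measurable borel\<close>)
  let ?\<nu> = "density lborel (\<lambda>x. ennreal (g x))"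
  \<comment> \<open>A common factor for two-sided comparison of \<open>g\<close> with
    \<open>f\<close>: removing the layer costs at most half of \<open>f\<close>, and adding it where
    \<open>f > p / 2\<close> raises \<open>f\<close> by a factor of at most
    \<open>1 + 2 * s / p\<close>. Second moment and entropy integrability pass from \<open>f\<close>
    to \<open>g\<close> through \<open>K\<close>.\<close>
  define K where "K = 2 + 2 * s / p"
  have K: "2 \<le> K" using s pq by (simp add: K_def)
  have g_lower: "f x / K \<le> g x" for x
  proof -
    have "f x / K \<le> f x / 2" using K f0[of x] by (intro divide_left_mono) auto
    also have "\<dots> \<le> g x" using kf[of x] kf[of "x + \<delta>"] by (simp add: g_def)
    finally show ?thesis .
  qed
  have g_upper: "g x \<le> K * f x" for x
  proof -
    have "k (x + \<delta>) \<le> (2 * s / p) * f x"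
      unfolding k' using L_bd[of x] s pq f0[of x] by (auto simp: field_simps split: split_indicator)
    then have "g x \<le> f x + (2 * s / p) * f x" using kf[of x] by (simp add: g_def)
    also have "\<dots> \<le> K * f x" using f0[of x] by (simp add: K_def algebra_simps)
    finally show ?thesis .
  qed
  have g_pos: "0 < g x" for x
    using g_lower[of x] pos[of x] K by (smt (verit) divide_pos_pos)
  have ln_diff: "\<bar>ln (g x) - ln (f x)\<bar> \<le> ln K" for x
  proof -
    have "ln (f x / K) \<le> ln (g x)" using g_lower[of x] pos[of x] K by (intro ln_mono) auto
    moreover have "ln (g x) \<le> ln (K * f x)" using g_upper[of x] g_pos[of x] by (intro ln_mono) auto
    ultimately show ?thesis using pos[of x] K by (simp add: ln_div ln_mult)
  qed
  have "(\<integral>\<^sup>+x. ennreal (f x) \<partial>lborel) = 1"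
    using R.emeasure_space_1 by (simp add: emeasure_density)
  then have intf: "integrable lborel f"
    using f0 by (subst integrable_iff_bounded) auto
  have intg: "integrable lborel (\<lambda>x. g x * (ln (g x) + U x))"
  proof (rule Bochner_Integration.integrable_bound)
    show "integrable lborel (\<lambda>x. K * (\<bar>f x * (ln (f x) + U x)\<bar> + ln K * f x))"
      using int intf by auto
    show "AE x in lborel. norm (g x * (ln (g x) + U x)) \<le> norm (K * (\<bar>f x * (ln (f x) + U x)\<bar> + ln K * f x))"
    proof (rule AE_I2)
      fix x
      have "\<bar>g x * (ln (g x) + U x)\<bar> = g x * \<bar>ln (g x) + U x\<bar>"
        using g_pos[of x] by (simp add: abs_mult)
      also have "\<dots> \<le> (K * f x) * (\<bar>ln (f x) + U x\<bar> + ln K)"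
        using g_upper[of x] g_pos[of x] ln_diff[of x] K f0[of x] by (intro mult_mono) auto
      also have "\<dots> = K * (\<bar>f x * (ln (f x) + U x)\<bar> + ln K * f x)"
      proof -
        have "(K * f x) * (t + ln K) = K * (f x * t + ln K * f x)" for t
          by (simp add: algebra_simps)
        then show ?thesis using f0[of x] by (simp only: abs_mult abs_of_nonneg)
      qed
      finally show "norm (g x * (ln (g x) + U x)) \<le> norm (K * (\<bar>f x * (ln (f x) + U x)\<bar> + ln K * f x))"
        by simp
    qed
  qed auto
  have \<nu>prob: "prob_space ?\<nu>"
  proof -
    have [measurable_cong]: "sets \<pi> = sets borel" using \<pi> by (auto simp: couplings_def)
    have "prob_space (distr \<pi> borel fst)" using \<pi> R by (auto simp: couplings_def)
    then have "prob_space \<pi>" by (rule prob_space_distrD[rotated]) measurable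
    then have "prob_space (distr \<pi> borel snd)" by (rule prob_space.prob_space_distr) measurable
    then show ?thesis using \<pi> by (auto simp: couplings_def)
  qed
  have \<nu>mom: "(\<integral>\<^sup>+x. ennreal (x\<^sup>2) \<partial>?\<nu>) < \<infinity>"
  proof -
    have "(\<integral>\<^sup>+x. ennreal (x\<^sup>2) \<partial>?\<nu>) = (\<integral>\<^sup>+x. ennreal (g x) * ennreal (x\<^sup>2) \<partial>lborel)"
      by (simp add: nn_integral_density)
    also have "\<dots> \<le> (\<integral>\<^sup>+x. ennreal K * (ennreal (f x) * ennreal (x\<^sup>2)) \<partial>lborel)"
    proof (rule nn_integral_mono)
      fix x
      have "ennreal (g x) \<le> ennreal K * ennreal (f x)"
        using g_upper[of x] K f0[of x] by (simp add: ennreal_mult[symmetric] ennreal_leI)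
      then show "ennreal (g x) * ennreal (x\<^sup>2) \<le> ennreal K * (ennreal (f x) * ennreal (x\<^sup>2))"
        unfolding mult.assoc[symmetric] by (rule mult_right_mono) simp
    qed
    also have "\<dots> = ennreal K * (\<integral>\<^sup>+x. ennreal (x\<^sup>2) \<partial>?R)"
      by (simp add: nn_integral_density nn_integral_cmult)
    also have "\<dots> < \<infinity>" using P2 by (auto simp: P2_def ennreal_mult_less_top)
    finally show ?thesis .
  qed
  note KLf = KL_gibbs(3)[OF N \<open>U \<in> borel_measurable borel\<close> \<open>f \<in> borel_measurable borel\<close> pos int]
  note KLg = KL_gibbs(3)[OF N \<open>U \<in> borel_measurable borel\<close> \<open>g \<in> borel_measurable borel\<close> g_pos intg]
  have \<nu>dom: "?\<nu> \<in> dom_F ?F"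
    using \<nu>prob \<nu>mom KLg by (simp add: dom_F_def P2_def)
  \<comment> \<open>Bounds for the chemical potential \<open>1 + ln g + U\<close> after the move:
    from above on the receiving interval, from below on the giving one.\<close>
  let ?a = "1 + ln (p + 2 * s) + U x0 + \<eta>" and ?b = "1 + ln (p + 3 * s) + U x0 - \<eta>"
  have "real_of_ereal (?F ?\<nu>) - real_of_ereal (?F ?R)
      = (\<integral>x. g x * (ln (g x) + U x) - f x * (ln (f x) + U x) \<partial>lborel)"
    using int intg by (simp add: KLf KLg)
  also have "\<dots> \<le> (\<integral>x. s * ?a * indicator {x0 - \<delta><..<x0} x - s * ?b * indicator {x0<..<x0 + \<delta>} x \<partial>lborel)"
  proof (rule integral_mono)
    fix x
    \<comment> \<open>The tangent is taken at the new density \<open>g\<close>, not at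
      \<open>f\<close>: convexity then bounds the change from above, as a drop requires.\<close>
    have "g x * (ln (g x) + U x) - f x * (ln (f x) + U x) \<le> (1 + ln (g x) + U x) * (g x - f x)"
      using xlnx_tangent[OF g_pos[of x] f0[of x]] by (simp add: algebra_simps)
    also have "\<dots> \<le> s * ?a * indicator {x0 - \<delta><..<x0} x - s * ?b * indicator {x0<..<x0 + \<delta>} x"
    proof -
      consider "x \<in> {x0 - \<delta><..<x0}" | "x \<in> {x0<..<x0 + \<delta>}"
        | "x \<notin> {x0 - \<delta><..<x0}" "x \<notin> {x0<..<x0 + \<delta>}" by blast
      then show ?thesis
      proof cases
        case 1
        then have gx: "g x = f x + s" by (auto simp: g_def k' k_def)
        have "ln (g x) \<le> ln (p + 2 * s)" using L_bd[OF 1] g_pos[of x] gx by (intro ln_mono) auto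
        then have "(1 + ln (g x) + U x) * s \<le> ?a * s"
          using L_bd[OF 1] s by (intro mult_right_mono) auto
        then show ?thesis using 1 gx by (simp add: mult.commute)
      next
        case 2
        then have gx: "g x = f x - s" by (auto simp: g_def k' k_def)
        have "ln (p + 3 * s) \<le> ln (g x)" using R_bd[OF 2] pq s gx by (intro ln_mono) auto
        then have "?b * s \<le> (1 + ln (g x) + U x) * s"
          using R_bd[OF 2] s by (intro mult_right_mono) auto
        then show ?thesis using 2 gx by (simp add: mult.commute)
      next
        case 3
        then have "g x = f x" by (auto simp: g_def k' k_def)
        then show ?thesis using 3 by simp
      qed
    qed
    finally show "g x * (ln (g x) + U x) - f x * (ln (f x) + U x)
      \<le> s * ?a * indicator {x0 - \<delta><..<x0} x - s * ?b * indicator {x0<..<x0 + \<delta>} x" .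
  qed (use int intg \<delta>(3) in \<open>auto intro!: Bochner_Integration.integrable_diff integrable_mult_right integrable_real_indicator\<close>)
  also have "\<dots> = s * ?a * \<delta> - s * ?b * \<delta>"
    using \<delta> by simp
  also have "\<dots> = - (2 * \<eta> * s * \<delta>)"
  proof -
    have "ln (p + 3 * s) = ln (p + 2 * s) + 4 * \<eta>" by (simp add: \<eta>_def field_simps)
    then show ?thesis by (simp add: algebra_simps)
  qed
  finally have drop: "2 * \<eta> * s * \<delta> \<le> \<bar>real_of_ereal (?F ?\<nu>) - real_of_ereal (?F ?R)\<bar>" by simp
  have "transport_cost \<pi> = (\<integral>\<^sup>+x. ennreal (s * \<delta>\<^sup>2) * indicator {x0<..<x0 + \<delta>} x \<partial>lborel)"
    unfolding \<pi>(2) by (intro nn_integral_cong) (auto simp: k_def split: split_indicator)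
  also have "\<dots> = ennreal (s * \<delta>\<^sup>2) * emeasure lborel {x0<..<x0 + \<delta>}"
    by (rule nn_integral_cmult_indicator) simp
  also have "\<dots> = ennreal (\<delta>\<^sup>2 * (s * \<delta>))"
    using \<delta> s by (simp add: ennreal_mult[symmetric] mult.commute mult.left_commute)
  finally have "W2 ?R ?\<nu> \<le> sqrt (\<delta>\<^sup>2 * (s * \<delta>))"
    using \<delta> s by (intro W2_le[OF \<pi>(1)]) auto
  then have W: "W2 ?R ?\<nu> \<le> \<delta> * sqrt (s * \<delta>)"
    using \<delta> by (simp add: real_sqrt_mult)
  have "2 * \<eta> * s * \<delta> \<le> C * W2 ?R ?\<nu>"
    using drop slope[OF \<nu>dom] W \<delta>(1) by linarith
  moreover have "W2 ?R ?\<nu> \<ge> 0" by (simp add: W2_def)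
  moreover have "0 < 2 * \<eta> * s * \<delta>" using \<eta> s \<delta> by simp
  \<comment> \<open>The slope bound says nothing about the sign of \<open>C\<close>; a positive drop
    forces it, and only then may the estimate of \<open>W2\<close> be multiplied by
    \<open>C\<close>.\<close>
  ultimately have "0 < C" by (metis less_le_trans zero_less_mult_pos2 mult_nonpos_nonneg not_le order_less_irrefl)
  then have "C * W2 ?R ?\<nu> \<le> (C * sqrt (s * \<delta>)) * \<delta>"
    using W by (simp add: mult.assoc mult.commute[of \<delta>])
  also have "\<dots> < 2 * \<eta> * s * \<delta>" using \<delta> by simp
  finally show False using \<open>2 * \<eta> * s * \<delta> \<le> C * W2 ?R ?\<nu>\<close> by simp
qed

subsection \<open>Gaussian core with exponential tails\<close>

text \<open>An even density with normalising constant \<open>D\<close>, tail rate \<open>a\<close>,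
  tail start \<open>c\<close> and log-amplitude \<open>b\<close>. For \<open>c > 1\<close> there is
  an empty gap between core and tails; for \<open>c = 1\<close> the function is positive
  everywhere.\<close>

definition profile :: "real \<Rightarrow> real \<Rightarrow> real \<Rightarrow> real \<Rightarrow> real \<Rightarrow> real" where
  "profile D a c b x =
     (if \<bar>x\<bar> < 1 then exp (- (x\<^sup>2 / 2)) / D else if \<bar>x\<bar> < c then 0 else exp (- a * \<bar>x\<bar> + b))"

lemma borel_measurable_profile [measurable]: "profile D a c b \<in> borel_measurable borel"
  unfolding profile_def[abs_def] by measurable

lemma profile_nonneg: "0 < D \<Longrightarrow> 0 \<le> profile D a c b x"
  by (simp add: profile_def)

lemma profile_pos: "0 < D \<Longrightarrow> 0 < profile D a 1 b x"
  by (simp add: profile_def)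

lemma profile_eventually_inner:
  assumes "\<bar>x\<bar> < 1"
  shows "\<forall>\<^sub>F y in nhds x. profile D a c b y = exp (- (y\<^sup>2 / 2)) / D"
proof -
  have "\<forall>\<^sub>F y in nhds x. y \<in> {-1<..<1}"
    using assms by (intro eventually_nhds_in_open) auto
  then show ?thesis by eventually_elim (auto simp: profile_def)
qed

text \<open>Near a nonzero \<open>x\<close> the absolute value is the linear function
  \<open>sgn x * y\<close>. In this form the derivative and continuity of both tails follow from one
  computation.\<close>

lemma profile_eventually_outer:
  assumes "1 \<le> c" "c < \<bar>x\<bar>"
  shows "\<forall>\<^sub>F y in nhds x. profile D a c b y = exp (- a * (sgn x * y) + b)"
proof -
  have "\<forall>\<^sub>F y in nhds x. y \<in> {y. c < sgn x * y}"
    using assms by (intro eventually_nhds_in_open open_Collect_less continuous_intros) (auto simp: abs_sgn mult.commute)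
  then show ?thesis
  proof eventually_elim
    case (elim y)
    then have "c < \<bar>y\<bar>" "sgn x * y = \<bar>y\<bar>"
      using assms by (auto simp: sgn_if split: if_splits)
    then show ?case using assms by (auto simp: profile_def)
  qed
qed

lemma profile_log_gradient_inner:
  assumes "0 < D" "\<bar>x\<bar> < 1"
  shows "has_log_gradient (profile D a c b) (- x) x"
proof -
  note ev = profile_eventually_inner[OF assms(2), of D a c b]
  have "((\<lambda>y. - (y\<^sup>2 / 2) - ln D) has_real_derivative - x) (at x)"
    by (auto intro!: derivative_eq_intros)
  moreover have "\<forall>\<^sub>F y in nhds x. ln (profile D a c b y) = - (y\<^sup>2 / 2) - ln D"
    using ev by eventually_elim (use assms in \<open>simp add: ln_div\<close>)
  ultimately have "((\<lambda>y. ln (profile D a c b y)) has_real_derivative - x) (at x)"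
    by (subst DERIV_cong_ev[OF refl _ refl]) auto
  moreover have "\<forall>\<^sub>F y in nhds x. 0 < profile D a c b y"
    using ev by eventually_elim (use assms in simp)
  ultimately show ?thesis by (simp add: has_log_gradient_def)
qed

lemma profile_log_gradient_outer:
  assumes "1 \<le> c" "c < \<bar>x\<bar>"
  shows "has_log_gradient (profile D a c b) (- a * sgn x) x"
proof -
  note ev = profile_eventually_outer[OF assms, of D a b]
  have "((\<lambda>y. - a * (sgn x * y) + b) has_real_derivative - a * sgn x) (at x)"
    by (auto intro!: derivative_eq_intros)
  moreover have "\<forall>\<^sub>F y in nhds x. ln (profile D a c b y) = - a * (sgn x * y) + b"
    using ev by eventually_elim simp
  ultimately have "((\<lambda>y. ln (profile D a c b y)) has_real_derivative - a * sgn x) (at x)"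
    by (subst DERIV_cong_ev[OF refl _ refl]) auto
  moreover have "\<forall>\<^sub>F y in nhds x. 0 < profile D a c b y"
    using ev by eventually_elim simp
  ultimately show ?thesis by (simp add: has_log_gradient_def)
qed

lemma gaussian_potential_deriv:
  "((\<lambda>x. x\<^sup>2 / 2 + k) has_real_derivative x) (at (x :: real))"
  by (auto intro!: derivative_eq_intros)

text \<open>In the core the slope of the potential cancels that of the log-density. The break points
  form a null set and the gap carries no mass, so extending the tail formula over them is an
  arbitrary choice.\<close>

lemma profile_velocity:
  assumes D: "0 < D" and c: "1 \<le> c"
  shows "is_KL_velocity (\<lambda>x. x\<^sup>2 / 2 + k) (density lborel (\<lambda>x. ennreal (profile D a c b x)))
     (\<lambda>x. if \<bar>x\<bar> < 1 then 0 else x - a * sgn x)"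
  unfolding is_KL_velocity_def
proof (intro conjI exI)
  show "is_lebesgue_density (density lborel (\<lambda>x. ennreal (profile D a c b x))) (profile D a c b)"
    using profile_nonneg[OF D] by (simp add: is_lebesgue_density_def)
  have "AE x in lborel. x \<noteq> 1 \<and> x \<noteq> -1 \<and> x \<noteq> c \<and> x \<noteq> - c"
    by (intro AE_conjI AE_lborel_singleton)
  then show "AE x in density lborel (\<lambda>x. ennreal (profile D a c b x)).
     \<exists>d e. ((\<lambda>x. x\<^sup>2 / 2 + k) has_real_derivative d) (at x) \<and> has_log_gradient (profile D a c b) e x \<and>
       (if \<bar>x\<bar> < 1 then 0 else x - a * sgn x) = d + e"
  proof (subst AE_density, goal_cases)
    case 2
    then show ?case
    proof eventually_elim
      case (elim x)
      show ?case
      proof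
        assume f: "0 < ennreal (profile D a c b x)"
        show "\<exists>d e. ((\<lambda>x. x\<^sup>2 / 2 + k) has_real_derivative d) (at x) \<and> has_log_gradient (profile D a c b) e x \<and>
          (if \<bar>x\<bar> < 1 then 0 else x - a * sgn x) = d + e"
        proof (cases "\<bar>x\<bar> < 1")
          case True
          then show ?thesis
            using gaussian_potential_deriv profile_log_gradient_inner[OF D True] by force
        next
          case False
          then have "c < \<bar>x\<bar>" using f elim by (auto simp: profile_def split: if_splits)
          then show ?thesis
            using False gaussian_potential_deriv profile_log_gradient_outer[OF c] by force
        qed
      qed
    qed
  qed simp
qed (auto)

section \<open>One Euler step on a profile\<close>

text \<open>The affine substitution \<open>y = \<sigma> h a + (1 - h) x\<close>, with \<sigma> the
  sign of the tail. Its dilation divides the rate by \<open>1 - h\<close>, its translation adds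
  \<open>h * a * (a / (1 - h))\<close> to the exponent, and its Jacobian adds
  \<open>- ln (1 - h)\<close>.\<close>

lemma tail_pushforward:
  fixes a b c h \<sigma> :: real and A :: "real set"
  assumes h: "0 < h" "h < 1" and \<sigma>: "\<sigma> = 1 \<or> \<sigma> = -1" and [measurable]: "A \<in> sets borel"
  shows "(\<integral>\<^sup>+x. ennreal (exp (- a * (\<sigma> * x) + b)) * indicator {x. c \<le> \<sigma> * x} x
      * indicator A (\<sigma> * h * a + (1 - h) * x) \<partial>lborel)
    = (\<integral>\<^sup>+y. ennreal (exp (- (a / (1 - h)) * (\<sigma> * y) + (b + h * a * (a / (1 - h)) - ln (1 - h))))
      * indicator {y. (1 - h) * c + h * a \<le> \<sigma> * y} y * indicator A y \<partial>lborel)"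
    (is "?L = (\<integral>\<^sup>+y. ?G y \<partial>lborel)")
proof -
  have "(\<integral>\<^sup>+y. ?G y \<partial>lborel) = ennreal (1 - h) * (\<integral>\<^sup>+x. ?G (\<sigma> * h * a + (1 - h) * x) \<partial>lborel)"
    using h by (subst nn_integral_real_affine[where c = "1 - h" and t = "\<sigma> * h * a"]) auto
  also have "\<dots> = (\<integral>\<^sup>+x. ennreal (1 - h) * ?G (\<sigma> * h * a + (1 - h) * x) \<partial>lborel)"
    by (rule nn_integral_cmult[symmetric]) measurable
  also have "\<dots> = ?L"
  proof (rule nn_integral_cong)
    fix x :: real
    have \<sigma>\<sigma>: "\<sigma> * \<sigma> = 1" using \<sigma> by auto
    have aff: "\<sigma> * (\<sigma> * h * a + (1 - h) * x) = h * a + (1 - h) * (\<sigma> * x)"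
    proof -
      have "\<sigma> * (\<sigma> * h * a + (1 - h) * x) = (\<sigma> * \<sigma>) * (h * a) + (1 - h) * (\<sigma> * x)"
        by (simp add: algebra_simps)
      then show ?thesis by (simp add: \<sigma>\<sigma>)
    qed
    have ind: "(1 - h) * c + h * a \<le> h * a + (1 - h) * (\<sigma> * x) \<longleftrightarrow> c \<le> \<sigma> * x"
      using h by simp
    have "- (a / (1 - h)) * (h * a + (1 - h) * (\<sigma> * x)) + (b + h * a * (a / (1 - h)) - ln (1 - h))
        = (- a * (\<sigma> * x) + b) - ln (1 - h)"
    proof -
      have q: "a / (1 - h) * (1 - h) = a" using h by simp
      have "- p * (h * a + (1 - h) * y) + (b + h * a * p - m) = - (p * (1 - h)) * y + b - m" for p y m
        by (simp add: algebra_simps)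
      from this[of "a / (1 - h)" "\<sigma> * x" "ln (1 - h)"] show ?thesis using h by (simp only: q)
    qed
    moreover have "(1 - h) * exp (t - ln (1 - h)) = exp t" for t
      using h by (simp add: exp_diff)
    ultimately have e: "(1 - h) * exp (- (a / (1 - h)) * (h * a + (1 - h) * (\<sigma> * x)) + (b + h * a * (a / (1 - h)) - ln (1 - h)))
        = exp (- a * (\<sigma> * x) + b)"
      by (simp only:)
    then show "ennreal (1 - h) * ?G (\<sigma> * h * a + (1 - h) * x)
      = ennreal (exp (- a * (\<sigma> * x) + b)) * indicator {x. c \<le> \<sigma> * x} x * indicator A (\<sigma> * h * a + (1 - h) * x)"
    proof -
      let ?y = "\<sigma> * h * a + (1 - h) * x"
      have "ennreal (1 - h) * ennreal (exp (- (a / (1 - h)) * (\<sigma> * ?y) + (b + h * a * (a / (1 - h)) - ln (1 - h))))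
          = ennreal (exp (- a * (\<sigma> * x) + b))"
        unfolding aff e[symmetric] using h by (intro ennreal_mult[symmetric]) auto
      moreover have "indicator {y. (1 - h) * c + h * a \<le> \<sigma> * y} ?y = (indicator {x. c \<le> \<sigma> * x} x :: ennreal)"
        by (simp only: indicator_def mem_Collect_eq aff ind)
      moreover have "r * (s * t * u) = (r * s) * t * u" for r s t u :: ennreal
        by (simp add: mult.assoc)
      ultimately show ?thesis by (simp only:)
    qed
  qed
  finally show ?thesis by simp
qed

lemma profile_pushforward:
  assumes D: "0 < D" and c: "1 \<le> c" and a: "1 \<le> a" and h: "0 < h" "h < 1"
  shows "distr (density lborel (\<lambda>x. ennreal (profile D a c b x))) borel
      (\<lambda>x. x - h * (if \<bar>x\<bar> < 1 then 0 else x - a * sgn x))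
    = density lborel (\<lambda>x. ennreal (profile D (a / (1 - h)) ((1 - h) * c + h * a)
        (b + h * a * (a / (1 - h)) - ln (1 - h)) x))" (is "distr ?R borel ?T = density lborel ?g")
proof (rule measure_eqI)
  fix A assume "A \<in> sets (distr ?R borel ?T)"
  then have A[measurable]: "A \<in> sets borel" by simp
  define core where "core x = ennreal (exp (- (x\<^sup>2 / 2)) / D) * indicator {x. \<bar>x\<bar> < 1} x" for x :: real
  define tail where "tail \<sigma> a c b x = ennreal (exp (- a * (\<sigma> * x) + b)) * indicator {x. c \<le> \<sigma> * x} x"
    for \<sigma> a c b x :: real
  have [measurable]: "core \<in> borel_measurable borel" "tail \<sigma> a c b \<in> borel_measurable borel" for \<sigma> a c b
    unfolding core_def tail_def by measurable
  have split: "ennreal (profile D a c b x) = core x + tail 1 a c b x + tail (-1) a c b x"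
    if "1 \<le> c" for a c b x
    using that by (auto simp: core_def tail_def profile_def indicator_def abs_if)
  let ?a = "a / (1 - h)" and ?c = "(1 - h) * c + h * a" and ?b = "b + h * a * (a / (1 - h)) - ln (1 - h)"
  \<comment> \<open>The image of the tail stays outside the core, so no masses are superposed and
    the pushforward can be reassembled as a profile.\<close>
  have c': "1 \<le> ?c"
  proof -
    have "(1 - h) * 1 + h * 1 \<le> ?c" using a c h by (intro add_mono mult_left_mono) auto
    then show ?thesis by simp
  qed
  have T: "ennreal (profile D a c b x) * indicator A (?T x) = core x * indicator A x
     + tail 1 a c b x * indicator A (1 * h * a + (1 - h) * x)
     + tail (-1) a c b x * indicator A ((-1) * h * a + (1 - h) * x)" for x
  proof -
    have "?T x = x" if "\<bar>x\<bar> < 1" using that by simp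
    moreover have "?T x = h * a + (1 - h) * x" if "c \<le> x" using that c by (auto simp: algebra_simps)
    moreover have "?T x = - h * a + (1 - h) * x" if "c \<le> - x" using that c by (auto simp: algebra_simps)
    \<comment> \<open>The four cases are core, right tail, left tail and gap; on the gap all three
      summands vanish.\<close>
    moreover have "\<bar>x\<bar> < 1 \<and> \<not> c \<le> x \<and> \<not> c \<le> - x \<or> \<not> \<bar>x\<bar> < 1 \<and> c \<le> x \<and> \<not> c \<le> - x \<or>
       \<not> \<bar>x\<bar> < 1 \<and> \<not> c \<le> x \<and> c \<le> - x \<or> \<not> \<bar>x\<bar> < 1 \<and> \<not> c \<le> x \<and> \<not> c \<le> - x"
      using c by linarith
    ultimately show ?thesis
      unfolding split[OF c] core_def tail_def
      by (elim disjE conjE) (simp_all del: if_split)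
  qed
  have "emeasure (distr ?R borel ?T) A = (\<integral>\<^sup>+x. indicator A x \<partial>distr ?R borel ?T)" by simp
  also have "\<dots> = (\<integral>\<^sup>+x. ennreal (profile D a c b x) * indicator A (?T x) \<partial>lborel)"
    by (subst nn_integral_distr) (auto simp: nn_integral_density)
  also have "\<dots> = (\<integral>\<^sup>+x. core x * indicator A x \<partial>lborel)
     + (\<integral>\<^sup>+x. tail 1 a c b x * indicator A (1 * h * a + (1 - h) * x) \<partial>lborel)
     + (\<integral>\<^sup>+x. tail (-1) a c b x * indicator A ((-1) * h * a + (1 - h) * x) \<partial>lborel)"
    unfolding T by (simp add: nn_integral_add)
  also have "\<dots> = (\<integral>\<^sup>+x. core x * indicator A x \<partial>lborel)
     + (\<integral>\<^sup>+x. tail 1 ?a ?c ?b x * indicator A x \<partial>lborel)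
     + (\<integral>\<^sup>+x. tail (-1) ?a ?c ?b x * indicator A x \<partial>lborel)"
    unfolding tail_def using tail_pushforward[OF h _ A, of 1 a b c] tail_pushforward[OF h _ A, of "-1" a b c] by simp
  also have "\<dots> = (\<integral>\<^sup>+x. ennreal (profile D ?a ?c ?b x) * indicator A x \<partial>lborel)"
    unfolding split[OF c'] by (simp add: nn_integral_add distrib_right)
  also have "\<dots> = emeasure (density lborel ?g) A"
    by (simp add: emeasure_density)
  finally show "emeasure (distr ?R borel ?T) A = emeasure (density lborel ?g) A" .
qed simp

lemma is_KL_velocity_KL_velocity:
  assumes "is_KL_velocity U \<rho> v"
  shows "is_KL_velocity U \<rho> (KL_velocity U \<rho>)"
  unfolding KL_velocity_def by (rule someI[of "is_KL_velocity U \<rho>", OF assms])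

text \<open>A pushforward sees the velocity only up to null sets, so the chosen
  \<open>KL_velocity\<close> may be replaced by the explicit one.\<close>

lemma profile_step:
  assumes D: "0 < D" and c: "1 \<le> c" and a: "1 \<le> a" and h: "0 < h" "h < 1"
    and U: "U = (\<lambda>x. x\<^sup>2 / 2 + k)"
    and \<rho>: "\<rho> = density lborel (\<lambda>x. ennreal (profile D a c b x))"
  shows "distr \<rho> borel (\<lambda>x. x - h * KL_velocity U \<rho> x)
    = density lborel (\<lambda>x. ennreal (profile D (a / (1 - h)) ((1 - h) * c + h * a)
        (b + h * a * (a / (1 - h)) - ln (1 - h)) x))"
proof -
  let ?v = "\<lambda>x. if \<bar>x\<bar> < 1 then 0 else x - a * sgn x"
  have v: "is_KL_velocity U \<rho> ?v"
    unfolding U \<rho> by (rule profile_velocity[OF D c])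
  note w = is_KL_velocity_KL_velocity[OF v]
  have [measurable]: "KL_velocity U \<rho> \<in> borel_measurable borel" "?v \<in> borel_measurable borel"
    using v w by (auto simp: is_KL_velocity_def)
  have [measurable_cong]: "sets \<rho> = sets borel" by (simp add: \<rho>)
  have "distr \<rho> borel (\<lambda>x. x - h * KL_velocity U \<rho> x) = distr \<rho> borel (\<lambda>x. x - h * ?v x)"
    by (rule distr_cong_AE) (use is_KL_velocity_unique[OF w v] in \<open>auto elim!: eventually_mono\<close>)
  then show ?thesis
    unfolding \<rho> using profile_pushforward[OF D c a h] by simp
qed

section \<open>Moment and entropy bounds for profiles\<close>

text \<open>Each half-line contributes a Gamma integral. Since tail rates are at least 1, this
  two-sided exponential weight dominates every profile and the initial density.\<close>

lemma integrable_abs_power_exp: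
  "integrable lborel (\<lambda>x :: real. \<bar>x\<bar> ^ n * exp (- \<bar>x\<bar>))"
proof (rule integrableI_nonneg)
  have half: "(\<integral>\<^sup>+x. ennreal (x ^ n * exp (- x)) * indicator {0..} x \<partial>lborel) < \<infinity>"
    by (simp only: nn_intergal_power_times_exp_Ici) simp
  have "(\<integral>\<^sup>+x. ennreal (\<bar>x\<bar> ^ n * exp (- \<bar>x\<bar>)) \<partial>lborel)
      \<le> (\<integral>\<^sup>+x. ennreal (x ^ n * exp (- x)) * indicator {0..} x
          + ennreal ((- x) ^ n * exp (- (- x))) * indicator {0..} (- x) \<partial>lborel)"
    by (intro nn_integral_mono) (auto simp: indicator_def abs_if)
  also have "\<dots> = (\<integral>\<^sup>+x. ennreal (x ^ n * exp (- x)) * indicator {0..} x \<partial>lborel)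
      + (\<integral>\<^sup>+x. ennreal ((- x) ^ n * exp (- (- x))) * indicator {0..} (- x) \<partial>lborel)"
    by (rule nn_integral_add) auto
  also have "(\<integral>\<^sup>+x. ennreal ((- x) ^ n * exp (- (- x))) * indicator {0..} (- x) \<partial>lborel)
      = (\<integral>\<^sup>+x. ennreal (x ^ n * exp (- x)) * indicator {0..} x \<partial>lborel)"
    by (subst (2) nn_integral_real_affine[where c = "-1" and t = 0]) auto
  finally show "(\<integral>\<^sup>+x. ennreal (\<bar>x\<bar> ^ n * exp (- \<bar>x\<bar>)) \<partial>lborel) < \<infinity>"
    using half by (auto simp: less_top[symmetric] top_unique)
qed auto

lemma abs_minus_half_le_square: "\<bar>x\<bar> - 1 / 2 \<le> x\<^sup>2 / 2" for x :: real
  using zero_le_power2[of "\<bar>x\<bar> - 1"] by (simp add: power2_diff)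

lemma profile_le_exp:
  assumes "0 < D" "1 \<le> a"
  shows "profile D a c b x \<le> (exp (1 / 2) / D + exp b) * exp (- \<bar>x\<bar>)"
proof (cases "\<bar>x\<bar> < 1")
  case True
  have "exp (- (x\<^sup>2 / 2)) \<le> exp (1 / 2) * exp (- \<bar>x\<bar>)"
    using abs_minus_half_le_square[of x] by (simp add: exp_add[symmetric])
  then have "profile D a c b x \<le> exp (1 / 2) / D * exp (- \<bar>x\<bar>)"
    using True assms by (simp add: profile_def divide_right_mono)
  also have "\<dots> \<le> (exp (1 / 2) / D + exp b) * exp (- \<bar>x\<bar>)"
    by (intro mult_right_mono) auto
  finally show ?thesis .
next
  case False
  have "\<bar>x\<bar> \<le> a * \<bar>x\<bar>" using assms mult_right_mono[of 1 a "\<bar>x\<bar>"] by simp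
  then have "profile D a c b x \<le> exp b * exp (- \<bar>x\<bar>)"
    using False by (simp add: profile_def exp_add[symmetric])
  also have "\<dots> \<le> (exp (1 / 2) / D + exp b) * exp (- \<bar>x\<bar>)"
    using assms by (intro mult_right_mono) auto
  finally show ?thesis .
qed

text \<open>In the core the Gaussian cancels against the potential and a constant is left; on the
  tails a quadratic remains. Quadratic growth is exactly what a finite second moment integrates, so
  this one bound serves both the entropy and the first variation against all competitors.\<close>

lemma ln_profile_bound:
  assumes "0 < D" "1 \<le> a"
  shows "\<bar>ln (profile D a 1 b x) + (x\<^sup>2 / 2 + k)\<bar> \<le> (\<bar>ln D\<bar> + \<bar>k\<bar> + \<bar>b\<bar> + a + 1) * (1 + x\<^sup>2)"
proof (cases "\<bar>x\<bar> < 1")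
  case True
  then have "\<bar>ln (profile D a 1 b x) + (x\<^sup>2 / 2 + k)\<bar> = \<bar>k - ln D\<bar>"
    using assms by (simp add: profile_def ln_div)
  also have "\<dots> \<le> (\<bar>ln D\<bar> + \<bar>k\<bar> + \<bar>b\<bar> + a + 1) * 1" using assms by simp
  also have "\<dots> \<le> (\<bar>ln D\<bar> + \<bar>k\<bar> + \<bar>b\<bar> + a + 1) * (1 + x\<^sup>2)"
    using assms by (intro mult_left_mono) auto
  finally show ?thesis .
next
  case False
  have x: "\<bar>x\<bar> \<le> 1 + x\<^sup>2"
    using abs_minus_half_le_square[of x] zero_le_power2[of x] by linarith
  have "\<bar>ln (profile D a 1 b x) + (x\<^sup>2 / 2 + k)\<bar> = \<bar>- a * \<bar>x\<bar> + b + x\<^sup>2 / 2 + k\<bar>"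
    using False by (simp add: profile_def)
  also have "\<dots> \<le> a * \<bar>x\<bar> + \<bar>b\<bar> + x\<^sup>2 / 2 + \<bar>k\<bar>"
  proof -
    have "0 \<le> a * \<bar>x\<bar>" using assms by simp
    then show ?thesis using zero_le_power2[of x] by linarith
  qed
  also have "\<dots> \<le> a * (1 + x\<^sup>2) + \<bar>b\<bar> * (1 + x\<^sup>2) + 1 * (1 + x\<^sup>2) + \<bar>k\<bar> * (1 + x\<^sup>2) + \<bar>ln D\<bar> * (1 + x\<^sup>2)"
  proof -
    have "a * \<bar>x\<bar> \<le> a * (1 + x\<^sup>2)" using x assms by (intro mult_left_mono) auto
    moreover have "\<bar>b\<bar> \<le> \<bar>b\<bar> * (1 + x\<^sup>2)" "\<bar>k\<bar> \<le> \<bar>k\<bar> * (1 + x\<^sup>2)" "0 \<le> \<bar>ln D\<bar> * (1 + x\<^sup>2)"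
      by (auto simp: distrib_left)
    moreover have "x\<^sup>2 / 2 \<le> 1 * (1 + x\<^sup>2)" by (simp add: field_simps add_increasing)
    ultimately show ?thesis by linarith
  qed
  also have "\<dots> = (\<bar>ln D\<bar> + \<bar>k\<bar> + \<bar>b\<bar> + a + 1) * (1 + x\<^sup>2)"
    by (simp add: algebra_simps)
  finally show ?thesis .
qed

lemma profile_second_moment:
  assumes "0 < D" "1 \<le> a"
  shows "integrable lborel (\<lambda>x. profile D a c b x * (1 + x\<^sup>2))"
proof (rule Bochner_Integration.integrable_bound)
  let ?M = "exp (1 / 2) / D + exp b"
  show "integrable lborel (\<lambda>x. ?M * (\<bar>x\<bar> ^ 0 * exp (- \<bar>x\<bar>) + \<bar>x\<bar> ^ 2 * exp (- \<bar>x\<bar>)))"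
    by (intro integrable_mult_right Bochner_Integration.integrable_add integrable_abs_power_exp)
  show "AE x in lborel. norm (profile D a c b x * (1 + x\<^sup>2))
      \<le> norm (?M * (\<bar>x\<bar> ^ 0 * exp (- \<bar>x\<bar>) + \<bar>x\<bar> ^ 2 * exp (- \<bar>x\<bar>)))"
  proof (rule AE_I2)
    fix x
    have "profile D a c b x * (1 + x\<^sup>2) \<le> (?M * exp (- \<bar>x\<bar>)) * (1 + x\<^sup>2)"
      using profile_le_exp[OF assms] by (intro mult_right_mono) auto
    also have "\<dots> = ?M * (\<bar>x\<bar> ^ 0 * exp (- \<bar>x\<bar>) + \<bar>x\<bar> ^ 2 * exp (- \<bar>x\<bar>))"
    proof -
      have "(M * e) * (1 + x\<^sup>2) = M * (\<bar>x\<bar> ^ 0 * e + \<bar>x\<bar> ^ 2 * e)" for M e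
        by (simp add: algebra_simps)
      then show ?thesis .
    qed
    also have "\<dots> \<le> norm \<dots>" by (simp only: real_norm_def abs_ge_self)
    finally show "norm (profile D a c b x * (1 + x\<^sup>2)) \<le> norm (?M * (\<bar>x\<bar> ^ 0 * exp (- \<bar>x\<bar>) + \<bar>x\<bar> ^ 2 * exp (- \<bar>x\<bar>)))"
      using profile_nonneg[OF assms(1), of a c b x] by (subst real_norm_def, subst abs_of_nonneg) auto
  qed
qed measurable

lemma profile_P2:
  assumes "0 < D" "1 \<le> a" "prob_space (density lborel (\<lambda>x. ennreal (profile D a c b x)))"
  shows "density lborel (\<lambda>x. ennreal (profile D a c b x)) \<in> P2"
proof -
  have f0: "0 \<le> profile D a c b x" for x by (rule profile_nonneg) fact
  have "(\<integral>\<^sup>+x. ennreal (x\<^sup>2) \<partial>density lborel (\<lambda>x. ennreal (profile D a c b x)))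
      = (\<integral>\<^sup>+x. ennreal (profile D a c b x * x\<^sup>2) \<partial>lborel)"
    using f0 by (simp add: nn_integral_density ennreal_mult)
  also have "\<dots> \<le> (\<integral>\<^sup>+x. ennreal (profile D a c b x * (1 + x\<^sup>2)) \<partial>lborel)"
    using f0 by (intro nn_integral_mono ennreal_leI mult_left_mono) auto
  also have "\<dots> = ennreal (\<integral>x. profile D a c b x * (1 + x\<^sup>2) \<partial>lborel)"
    using f0 by (intro nn_integral_eq_integral profile_second_moment assms) auto
  finally have "(\<integral>\<^sup>+x. ennreal (x\<^sup>2) \<partial>density lborel (\<lambda>x. ennreal (profile D a c b x))) < \<infinity>"
    by (rule le_less_trans) simp
  then show ?thesis using assms by (simp add: P2_def)
qed

lemma profile_entropy_integrable:
  assumes "0 < D" "1 \<le> a"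
  shows "integrable lborel (\<lambda>x. profile D a 1 b x * (ln (profile D a 1 b x) + (x\<^sup>2 / 2 + k)))"
proof (rule Bochner_Integration.integrable_bound)
  let ?K = "\<bar>ln D\<bar> + \<bar>k\<bar> + \<bar>b\<bar> + a + 1"
  show "integrable lborel (\<lambda>x. ?K * (profile D a 1 b x * (1 + x\<^sup>2)))"
    using profile_second_moment[OF assms] by simp
  show "AE x in lborel. norm (profile D a 1 b x * (ln (profile D a 1 b x) + (x\<^sup>2 / 2 + k)))
      \<le> norm (?K * (profile D a 1 b x * (1 + x\<^sup>2)))"
  proof (rule AE_I2)
    fix x
    have f0: "0 \<le> profile D a 1 b x" by (rule profile_nonneg) fact
    have "norm (profile D a 1 b x * (ln (profile D a 1 b x) + (x\<^sup>2 / 2 + k)))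
        \<le> profile D a 1 b x * (?K * (1 + x\<^sup>2))"
      using ln_profile_bound[OF assms] f0 by (simp add: abs_mult mult_left_mono)
    also have "\<dots> \<le> norm (?K * (profile D a 1 b x * (1 + x\<^sup>2)))"
      by (simp only: mult.left_commute real_norm_def abs_ge_self)
    finally show "norm (profile D a 1 b x * (ln (profile D a 1 b x) + (x\<^sup>2 / 2 + k)))
      \<le> norm (?K * (profile D a 1 b x * (1 + x\<^sup>2)))" .
  qed
qed measurable

section \<open>Continuity, jump and gradients of gapless profiles\<close>

text \<open>The points of \<open>S\<close> where the functions differ form a set that is both open
  and null, hence empty; the closed set of agreement then contains the closure.\<close>

lemma continuous_eq_on_closure:
  fixes f g :: "real \<Rightarrow> real"
  assumes "continuous_on UNIV f" "continuous_on UNIV g" and S: "open S"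
    and ae: "AE x in lborel. x \<in> S \<longrightarrow> f x = g x" and x0: "x0 \<in> closure S"
  shows "f x0 = g x0"
proof -
  let ?N = "S \<inter> {x. f x \<noteq> g x}"
  have closed: "closed {x. f x = g x}"
    using assms by (intro closed_Collect_eq)
  then have "open ?N"
    using S by (simp add: Collect_neg_eq open_Int closed_def)
  moreover from this have "?N \<in> sets lborel" by simp
  then have "?N \<in> null_sets lborel"
    using ae by (subst AE_iff_null_sets) (auto elim!: eventually_mono)
  then have "negligible ?N"
    unfolding negligible_iff_null_sets by (rule null_sets_completionI)
  ultimately have "?N = {}" using open_not_negligible by blast
  then have "S \<subseteq> {x. f x = g x}" by auto
  then have "closure S \<subseteq> {x. f x = g x}" using closed by (rule closure_minimal)
  then show ?thesis using x0 by auto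
qed

lemma profile_isCont:
  assumes "\<bar>x\<bar> \<noteq> 1"
  shows "isCont (profile D a 1 b) x"
proof (cases "\<bar>x\<bar> < 1")
  case True
  show ?thesis
    unfolding isCont_cong[OF profile_eventually_inner[OF True]] divide_inverse
    by (intro continuous_intros)
next
  case False
  then have x: "1 < \<bar>x\<bar>" using assms by simp
  show ?thesis
    unfolding isCont_cong[OF profile_eventually_outer[OF order_refl x]] by (intro continuous_intros)
qed

text \<open>A continuous representative would have to take at 1 the boundary value of the core and
  that of the tail. Arguing almost everywhere covers all representatives at once.\<close>

lemma profile_not_continuous:
  assumes D: "0 < D" and jump: "exp (- (1 / 2)) / D < exp (- a + b)"
    and f: "is_lebesgue_density (density lborel (\<lambda>x. ennreal (profile D a 1 b x))) f"
  shows "\<not> continuous_on UNIV f"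
proof
  assume cont: "continuous_on UNIV f"
  have fm: "f \<in> borel_measurable borel" "\<And>x. 0 \<le> f x"
    and eq: "density lborel (\<lambda>x. ennreal (profile D a 1 b x)) = density lborel (\<lambda>x. ennreal (f x))"
    using f by (auto simp: is_lebesgue_density_def)
  have "AE x in lborel. ennreal (profile D a 1 b x) = ennreal (f x)"
    using sigma_finite_measure.density_unique_iff[OF sigma_finite_lborel,
        of "\<lambda>x. ennreal (profile D a 1 b x)" "\<lambda>x. ennreal (f x)"] fm eq by simp
  then have ae: "AE x in lborel. profile D a 1 b x = f x"
    using fm profile_nonneg[OF D] by (auto elim!: eventually_mono)
  have "f 1 = exp (- (1\<^sup>2 / 2)) / D"
  proof (rule continuous_eq_on_closure[OF cont _ open_greaterThanLessThan[of "0::real" 1]])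
    show "AE x in lborel. x \<in> {0<..<1} \<longrightarrow> f x = exp (- (x\<^sup>2 / 2)) / D"
      using ae by eventually_elim (auto simp: profile_def)
  qed (use D in \<open>auto intro!: continuous_intros\<close>)
  moreover have "f 1 = exp (- a * 1 + b)"
  proof (rule continuous_eq_on_closure[OF cont _ open_greaterThan[of "1::real"]])
    show "AE x in lborel. x \<in> {1<..} \<longrightarrow> f x = exp (- a * x + b)"
      using ae by eventually_elim (auto simp: profile_def)
  qed (auto intro!: continuous_intros)
  ultimately show False using jump by simp
qed

lemma profile_limits:
  assumes "0 < D"
  shows "(profile D a 1 b \<longlongrightarrow> exp (- (1 / 2)) / D) (at_left 1)"
    and "(profile D a 1 b \<longlongrightarrow> exp (- a + b)) (at_right 1)"
proof -
  have "((\<lambda>x. exp (- (x\<^sup>2 / 2)) / D) \<longlongrightarrow> exp (- (1\<^sup>2 / 2)) / D) (at_left 1)"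
    using assms by (intro tendsto_intros) auto
  moreover have "\<forall>\<^sub>F x in at_left 1. exp (- (x\<^sup>2 / 2)) / D = profile D a 1 b x"
    unfolding eventually_at_left_field by (intro exI[of _ 0]) (auto simp: profile_def)
  ultimately show "(profile D a 1 b \<longlongrightarrow> exp (- (1 / 2)) / D) (at_left 1)"
    using Lim_transform_eventually by fastforce
  have "((\<lambda>x. exp (- a * x + b)) \<longlongrightarrow> exp (- a * 1 + b)) (at_right 1)"
    by (intro tendsto_intros)
  moreover have "\<forall>\<^sub>F x in at_right 1. exp (- a * x + b) = profile D a 1 b x"
    unfolding eventually_at_right_field by (intro exI[of _ 2]) (auto simp: profile_def)
  ultimately show "(profile D a 1 b \<longlongrightarrow> exp (- a + b)) (at_right 1)"
    using Lim_transform_eventually by fastforce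
qed

lemma profile_has_gradient:
  assumes "0 < D" "\<bar>x\<bar> \<noteq> 1"
  shows "\<exists>d. has_gradient (\<lambda>x. ereal (ln (profile D a 1 b x * exp (x\<^sup>2 / 2 + k)))) d x"
proof -
  obtain e where "has_log_gradient (profile D a 1 b) e x"
    using profile_log_gradient_inner[OF assms(1)] profile_log_gradient_outer[of 1 x] assms(2)
    by (metis linorder_neqE_linordered_idom order_refl)
  then have "((\<lambda>y. ln (profile D a 1 b y) + (y\<^sup>2 / 2 + k)) has_real_derivative e + x) (at x)"
    unfolding has_log_gradient_def by (intro DERIV_add gaussian_potential_deriv) auto
  moreover have "ln (profile D a 1 b y * exp (y\<^sup>2 / 2 + k)) = ln (profile D a 1 b y) + (y\<^sup>2 / 2 + k)" for y
    using profile_pos[OF assms(1), of a b y] by (simp add: ln_mult)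
  ultimately show ?thesis by (auto simp: has_gradient_def)
qed

section \<open>Membership in the two differentiability classes\<close>

lemma P2_integrable_quadratic_bound:
  assumes "\<nu> \<in> P2" and [measurable]: "w \<in> borel_measurable borel" and "\<And>x. \<bar>w x\<bar> \<le> K * (1 + x\<^sup>2)"
  shows "integrable \<nu> w"
proof (rule Bochner_Integration.integrable_bound)
  interpret prob_space \<nu> using assms by (simp add: P2_def)
  have [measurable_cong]: "sets \<nu> = sets borel" using assms by (simp add: P2_def)
  have "integrable \<nu> (\<lambda>x. x\<^sup>2)"
    using assms by (intro integrableI_nonneg) (auto simp: P2_def)
  then show "integrable \<nu> (\<lambda>x. K * (1 + x\<^sup>2))" by simp
  show "AE x in \<nu>. norm (w x) \<le> norm (K * (1 + x\<^sup>2))"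
    using order_trans[OF assms(3) abs_ge_self] by auto
  show "w \<in> borel_measurable \<nu>" by measurable
qed

lemma prob_space_gaussian:
  "prob_space (density lborel (\<lambda>x. ennreal (exp (- (x\<^sup>2 / 2 + ln (sqrt (2 * pi)))))))"
proof -
  have "exp (- (x\<^sup>2 / 2 + ln (sqrt (2 * pi)))) = std_normal_density x" for x
    by (simp add: std_normal_density_def exp_diff exp_minus)
  then show ?thesis using prob_space_normal_density[of 1 0] by simp
qed

text \<open>Without a gap the relative density is positive, as the first variation requires, and its
  logarithm fails to have a gradient at most at the null set of the points 1 and -1. The jump does
  no harm here.\<close>

lemma profile_in_S_f:
  assumes D: "0 < D" and a: "1 \<le> a"
    and k: "k = ln (sqrt (2 * pi))"
    and prob: "prob_space (density lborel (\<lambda>x. ennreal (profile D a 1 b x)))"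
  shows "density lborel (\<lambda>x. ennreal (profile D a 1 b x))
    \<in> S_f (\<lambda>\<mu>. KL \<mu> (density lborel (\<lambda>x. ennreal (exp (- (x\<^sup>2 / 2 + k))))))"
proof -
  let ?R = "density lborel (\<lambda>x. ennreal (profile D a 1 b x))"
  let ?N = "density lborel (\<lambda>x. ennreal (exp (- (x\<^sup>2 / 2 + k))))"
  let ?r = "\<lambda>x. profile D a 1 b x * exp (x\<^sup>2 / 2 + k)"
  have N: "prob_space ?N" unfolding k by (rule prob_space_gaussian)
  note pos = profile_pos[OF D, of a b]
  note G = KL_gibbs[where U = "\<lambda>x. x\<^sup>2 / 2 + k" and f = "profile D a 1 b", OF N refl _ _ pos profile_entropy_integrable[OF D a, of b k], simplified]
  have dom: "?R \<in> dom_F (\<lambda>\<mu>. KL \<mu> ?N)"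
    using profile_P2[OF D a prob] G(3) by (simp add: dom_F_def)
  have "is_first_variation (\<lambda>\<mu>. KL \<mu> ?N) (density ?N (\<lambda>x. ennreal (?r x))) (\<lambda>x. ereal (ln (?r x)))"
  proof (rule KL_first_variation[OF N])
    show "prob_space (density ?N (\<lambda>x. ennreal (?r x)))" using prob G(1) by simp
    fix \<nu> assume "\<nu> \<in> dom_F (\<lambda>\<mu>. KL \<mu> ?N)"
    then have "\<nu> \<in> P2" by (simp add: dom_F_def)
    moreover have "ln (?r x) = ln (profile D a 1 b x) + (x\<^sup>2 / 2 + k)" for x
      using pos[of x] by (simp add: ln_mult)
    ultimately show "integrable \<nu> (\<lambda>x. ln (?r x))"
      using ln_profile_bound[OF D a] by (intro P2_integrable_quadratic_bound) auto
  qed (use pos G(2) in auto)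
  then have fv: "is_first_variation (\<lambda>\<mu>. KL \<mu> ?N) ?R (\<lambda>x. ereal (ln (?r x)))"
    using G(1) by simp
  have "AE x in lborel. x \<noteq> 1 \<and> x \<noteq> -1"
    by (intro AE_conjI AE_lborel_singleton)
  then have "AE x in lborel. \<exists>d. has_gradient (\<lambda>x. ereal (ln (?r x))) d x"
  proof eventually_elim
    case (elim x)
    then have "\<bar>x\<bar> \<noteq> 1" by auto
    then show ?case by (rule profile_has_gradient[OF D])
  qed
  then have "AE x in ?R. \<exists>d. has_gradient (\<lambda>x. ereal (ln (?r x))) d x"
    by (subst AE_density) (auto elim!: eventually_mono)
  then show ?thesis using dom fv by (auto simp: S_f_def)
qed

lemma profile_not_in_S_W:
  assumes D: "0 < D" and a: "1 \<le> a" and k: "k = ln (sqrt (2 * pi))"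
    and prob: "prob_space (density lborel (\<lambda>x. ennreal (profile D a 1 b x)))"
    and jump: "exp (- (1 / 2)) / D < exp (- a + b)"
  shows "density lborel (\<lambda>x. ennreal (profile D a 1 b x))
    \<notin> S_W (\<lambda>\<mu>. KL \<mu> (density lborel (\<lambda>x. ennreal (exp (- (x\<^sup>2 / 2 + k))))))"
proof (rule jump_not_in_S_W[OF _ refl, where f = "profile D a 1 b" and U = "\<lambda>x. x\<^sup>2 / 2 + k"])
  show "prob_space (density lborel (\<lambda>x. ennreal (exp (- (x\<^sup>2 / 2 + k)))))"
    unfolding k by (rule prob_space_gaussian)
qed (use profile_pos[OF D] profile_entropy_integrable[OF D a] profile_P2[OF D a prob] profile_limits[OF D] jump D in
    \<open>auto intro!: continuous_intros\<close>)

section \<open>The initial measure and the iteration\<close>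

lemma prob_space_initial:
  fixes V0 :: "real \<Rightarrow> real" and D0 :: real
  assumes V0: "V0 = (\<lambda>x. if x \<in> {-1<..<1} then x\<^sup>2 / 2 else \<bar>x\<bar> - 1 / 2)"
    and D0: "D0 = (\<integral>x. exp (- V0 x) \<partial>lborel)"
  shows "0 < D0" and "prob_space (density lborel (\<lambda>x. ennreal (1 / D0 * exp (- V0 x))))"
proof -
  have [measurable]: "V0 \<in> borel_measurable borel" unfolding V0 by measurable
  have int: "integrable lborel (\<lambda>x. exp (- V0 x))"
  proof (rule Bochner_Integration.integrable_bound)
    show "integrable lborel (\<lambda>x::real. exp (1 / 2) * (\<bar>x\<bar> ^ 0 * exp (- \<bar>x\<bar>)))"
      by (intro integrable_mult_right integrable_abs_power_exp)
    show "AE x in lborel. norm (exp (- V0 x)) \<le> norm (exp (1 / 2) * (\<bar>x\<bar> ^ 0 * exp (- \<bar>x\<bar>)))"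
    proof (rule AE_I2)
      fix x
      have "- V0 x \<le> 1 / 2 - \<bar>x\<bar>"
        using abs_minus_half_le_square[of x] by (auto simp: V0)
      then show "norm (exp (- V0 x)) \<le> norm (exp (1 / 2) * (\<bar>x\<bar> ^ 0 * exp (- \<bar>x\<bar>)))"
        by (simp add: exp_add[symmetric])
    qed
  qed measurable
  have "D0 \<noteq> 0"
  proof
    assume "D0 = 0"
    then have "AE x in lborel. exp (- V0 x) = 0"
      using integral_nonneg_eq_0_iff_AE[OF int] by (simp add: D0)
    then have "emeasure lborel (UNIV :: real set) = 0"
      using AE_iff_measurable[of UNIV lborel "\<lambda>x. exp (- V0 x) = 0"] by simp
    then show False by simp
  qed
  moreover have "0 \<le> D0" unfolding D0 by simp
  ultimately show D: "0 < D0" by simp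
  show "prob_space (density lborel (\<lambda>x. ennreal (1 / D0 * exp (- V0 x))))"
  proof (rule prob_spaceI)
    have "emeasure (density lborel (\<lambda>x. ennreal (1 / D0 * exp (- V0 x)))) UNIV
        = (\<integral>\<^sup>+x. ennreal (1 / D0 * exp (- V0 x)) \<partial>lborel)"
      by (simp add: emeasure_density)
    also have "\<dots> = ennreal (\<integral>x. 1 / D0 * exp (- V0 x) \<partial>lborel)"
      using int D by (intro nn_integral_eq_integral) auto
    also have "(\<integral>x. 1 / D0 * exp (- V0 x) \<partial>lborel) = 1"
      using D by (simp add: D0[symmetric])
    finally show "emeasure (density lborel (\<lambda>x. ennreal (1 / D0 * exp (- V0 x))))
        (space (density lborel (\<lambda>x. ennreal (1 / D0 * exp (- V0 x))))) = 1" by simp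
  qed
qed

theorem proposition3p2:
  fixes U V0 :: "real \<Rightarrow> real"
    and D0 :: real
    and rho_star :: "real measure"
    and F :: "real measure \<Rightarrow> ereal"
    and h :: "nat \<Rightarrow> real"
    and T :: "nat \<Rightarrow> real \<Rightarrow> real"
    and \<rho> :: "nat \<Rightarrow> real measure"
  assumes U: "U = (\<lambda>x. x\<^sup>2 / 2 + ln (sqrt (2 * pi)))"
    and rho_star: "rho_star = density lborel (\<lambda>x. ennreal (exp (- U x)))"
    and F: "F = (\<lambda>\<mu>. KL \<mu> rho_star)"
    and V0: "V0 = (\<lambda>x. if x \<in> {-1<..<1} then x\<^sup>2 / 2 else \<bar>x\<bar> - 1 / 2)"
    and D0: "D0 = (\<integral>x. exp (- V0 x) \<partial>lborel)"
    and h: "\<And>n. h n \<in> {0<..<1}"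
    and rho_0: "\<rho> 0 = density lborel (\<lambda>x. ennreal (1 / D0 * exp (- V0 x)))"
    and T: "\<And>n. T n = (\<lambda>x. x - h n * KL_velocity U (\<rho> n) x)"
    and rho_Suc: "\<And>n. \<rho> (Suc n) = distr (\<rho> n) borel (T n)"
  shows "(absolutely_continuous lborel (\<rho> 1) \<and>
          (\<forall>f. is_lebesgue_density (\<rho> 1) f \<longrightarrow> \<not> continuous_on UNIV f) \<and>
          (\<exists>f. is_lebesgue_density (\<rho> 1) f \<and> {x. \<not> isCont f x} \<in> null_sets lborel) \<and>
          \<rho> 1 \<in> S_f F - S_W F) \<and>
         (\<forall>n. \<exists>a c b. 1 \<le> a \<and> 1 \<le> c \<and>
           (\<exists>f. is_lebesgue_density (\<rho> n) f \<and>
              (\<forall>x\<in>{0..<1}. f x = 1 / D0 * exp (- (x\<^sup>2 / 2))) \<and>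
              (\<forall>x\<in>{1..<c}. f x = 0) \<and>
              (\<forall>x\<in>{c..}. f x = exp (- a * x + b)) \<and>
              (\<forall>x<0. f x = f (- x))))"
proof -
  note D = prob_space_initial(1)[OF V0 D0] and prob0 = prob_space_initial(2)[OF V0 D0]
  \<comment> \<open>Absorbs the offset of \<open>V0\<close> and the normalisation into the exponent,
    so that \<rho> 0 is itself a profile with \<open>a = c = 1\<close> and no jump.\<close>
  define b0 where "b0 = 1 / 2 - ln D0"
  have r0: "\<rho> 0 = density lborel (\<lambda>x. ennreal (profile D0 1 1 b0 x))"
  proof -
    have "1 / D0 * exp (- V0 x) = profile D0 1 1 b0 x" for x
    proof (cases "\<bar>x\<bar> < 1")
      case False
      have "exp (- 1 * \<bar>x\<bar> + b0) = exp (- (\<bar>x\<bar> - 1 / 2) - ln D0)" by (simp add: b0_def)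
      also have "\<dots> = 1 / D0 * exp (- (\<bar>x\<bar> - 1 / 2))" using D by (simp only: exp_diff exp_ln) simp
      finally show ?thesis using False by (auto simp: V0 profile_def)
    qed (auto simp: V0 profile_def)
    then show ?thesis by (simp only: rho_0)
  qed
  have step: "\<rho> (Suc n) = density lborel (\<lambda>x. ennreal (profile D0 (a / (1 - h n))
      ((1 - h n) * c + h n * a) (b + h n * a * (a / (1 - h n)) - ln (1 - h n)) x))"
    if "1 \<le> a" "1 \<le> c" "\<rho> n = density lborel (\<lambda>x. ennreal (profile D0 a c b x))" for n a c b
    unfolding rho_Suc T using profile_step[OF D that(2,1) _ _ U that(3), of "h n"] h[of n] by simp
  \<comment> \<open>Both lower bounds belong to the invariant: \<open>a \<ge> 1\<close> keeps the
    next tail start at least 1, and \<open>c \<ge> 1\<close> keeps the tail off the core.\<close>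
  have shape: "\<exists>a c b. 1 \<le> a \<and> 1 \<le> c \<and> \<rho> n = density lborel (\<lambda>x. ennreal (profile D0 a c b x))" for n
  proof (induction n)
    case 0
    show ?case using r0 by (intro exI[of _ 1] exI[of _ b0]) simp
  next
    case (Suc n)
    then obtain a c b where acb: "1 \<le> a" "1 \<le> c" "\<rho> n = density lborel (\<lambda>x. ennreal (profile D0 a c b x))"
      by blast
    have "1 \<le> a / (1 - h n)" using acb h[of n] by (simp add: field_simps)
    moreover have "1 \<le> (1 - h n) * c + h n * a"
    proof -
      have "(1 - h n) * 1 + h n * 1 \<le> (1 - h n) * c + h n * a"
        using acb h[of n] by (intro add_mono mult_left_mono) auto
      then show ?thesis by simp
    qed
    ultimately show ?case using step[OF acb] by blast
  qed
  have two: "\<exists>a c b. 1 \<le> a \<and> 1 \<le> c \<and>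
           (\<exists>f. is_lebesgue_density (\<rho> n) f \<and>
              (\<forall>x\<in>{0..<1}. f x = 1 / D0 * exp (- (x\<^sup>2 / 2))) \<and>
              (\<forall>x\<in>{1..<c}. f x = 0) \<and>
              (\<forall>x\<in>{c..}. f x = exp (- a * x + b)) \<and>
              (\<forall>x<0. f x = f (- x)))" for n
  proof -
    obtain a c b where acb: "1 \<le> a" "1 \<le> c" "\<rho> n = density lborel (\<lambda>x. ennreal (profile D0 a c b x))"
      using shape by blast
    show ?thesis
      using acb profile_nonneg[OF D]
      by (intro exI[of _ a] exI[of _ c] exI[of _ b] exI[of _ "profile D0 a c b"] conjI)
        (auto simp: is_lebesgue_density_def profile_def)
  qed
  \<comment> \<open>The step map evaluated at \<open>a = c = 1\<close> and \<open>b0\<close>; the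
    new tail start is \<open>(1 - h 0) + h 0 = 1\<close>.\<close>
  define a1 where "a1 = 1 / (1 - h 0)"
  define b1 where "b1 = b0 + h 0 * a1 - ln (1 - h 0)"
  have a1: "1 \<le> a1" using h[of 0] by (simp add: a1_def field_simps)
  have r1: "\<rho> 1 = density lborel (\<lambda>x. ennreal (profile D0 a1 1 b1 x))"
    using step[OF _ _ r0] by (simp add: a1_def b1_def)
  have jump: "exp (- (1 / 2)) / D0 < exp (- a1 + b1)"
  proof -
    \<comment> \<open>By this identity \<open>h 0 * a1 - a1 = -1\<close>, which combines with the
      \<open>1 / 2\<close> in \<open>b0\<close>: the tail value at 1 is the core value divided by
      \<open>1 - h 0\<close>.\<close>
    have "a1 * (1 - h 0) = 1" using h[of 0] by (simp add: a1_def)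
    then have "- a1 + b1 = - (1 / 2) - ln D0 - ln (1 - h 0)"
      by (simp add: b1_def b0_def algebra_simps)
    moreover have "ln (1 - h 0) < 0" using h[of 0] by simp
    ultimately have "exp (- (1 / 2) - ln D0) < exp (- a1 + b1)" by simp
    then show ?thesis using D by (simp add: exp_diff)
  qed
  \<comment> \<open>Unit mass is inherited through the pushforward rather than computed from the
    profile; this needs measurability of the chosen velocity.\<close>
  have prob1: "prob_space (\<rho> 1)"
  proof -
    have v: "is_KL_velocity U (\<rho> 0) (\<lambda>x. if \<bar>x\<bar> < 1 then 0 else x - 1 * sgn x)"
      unfolding U r0 by (rule profile_velocity[OF D]) simp
    have [measurable]: "KL_velocity U (\<rho> 0) \<in> borel_measurable borel"
      using is_KL_velocity_KL_velocity[OF v] by (simp add: is_KL_velocity_def)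
    have [measurable_cong]: "sets (\<rho> 0) = sets borel" by (simp add: rho_0)
    have "prob_space (\<rho> 0)" using prob0 by (simp add: rho_0)
    then have "prob_space (distr (\<rho> 0) borel (T 0))"
      by (rule prob_space.prob_space_distr) (simp add: T)
    then show ?thesis by (simp add: rho_Suc)
  qed
  have "{x. \<not> isCont (profile D0 a1 1 b1) x} \<subseteq> {1, -1}"
  proof
    fix x assume "x \<in> {x. \<not> isCont (profile D0 a1 1 b1) x}"
    then have "\<bar>x\<bar> = 1" using profile_isCont by blast
    then show "x \<in> {1, -1}" by auto
  qed
  then have "countable {x. \<not> isCont (profile D0 a1 1 b1) x}"
    by (rule countable_subset) simp
  then have null: "{x. \<not> isCont (profile D0 a1 1 b1) x} \<in> null_sets lborel"
    by (rule countable_imp_null_set_lborel)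
  have dens: "is_lebesgue_density (\<rho> 1) (profile D0 a1 1 b1)"
    unfolding is_lebesgue_density_def r1 using profile_nonneg[OF D] by simp
  have "absolutely_continuous lborel (\<rho> 1)"
    unfolding r1 by (intro absolutely_continuousI_density) measurable
  moreover have "\<forall>f. is_lebesgue_density (\<rho> 1) f \<longrightarrow> \<not> continuous_on UNIV f"
    unfolding r1 using profile_not_continuous[OF D jump] by blast
  moreover have "\<rho> 1 \<in> S_f F"
    using profile_in_S_f[OF D a1 refl, of b1] prob1 unfolding r1 F rho_star U by simp
  moreover have "\<rho> 1 \<notin> S_W F"
    using profile_not_in_S_W[OF D a1 refl, of b1] prob1 jump unfolding r1 F rho_star U by simp
  ultimately show ?thesis using dens null two by blast
qed

end
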